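(* Suppose $w\colon\Gamma\to[0,+\infty]$ is lower semi-continuous with compact sub-level sets. Then for every minimiser $\sigma^*$ of $\mathrm E(\sigma)=\mathrm F(\sigma)+\int_\Gamma w\,d\sigma$ over $\sigma\in\mathcal M^+(\Gamma)$, one has $$\gamma\in G(\gamma(t_0),\dots,\gamma(t_T))\qquad\text{for }\sigma^*\text{-a.e. }\gamma\in\operatorname{supp}(\sigma^* ),$$ where, for $\tilde\gamma=(\tilde\gamma_0,\dots,\tilde\gamma_T)\in\tilde\Gamma$, $$G(\tilde\gamma)=\operatorname{argmin}_{\gamma\in\Gamma}\{\,w(\gamma)\ :\ \gamma(t_j)=\tilde\gamma_j\ \text{for all } j=0,\dots,T,\ w(\gamma)<+\infty\,\}.$$
   Context: $\Omega\subset\mathbb R^d$ ($d\ge1$) is open, bounded and convex. Let $\Gamma_\infty$ be the set of pairs $\gamma=(h,\xi)$ with $h\in C([0,1];[-1,1])$ and $\xi\colon[0,1]\to\bar\Omega$ such that $\xi|_{\{h\ne0\}}$ is continuous, where two pairs $(h_1,\xi_1),(h_2,\xi_2)$ are identified if $h_1=h_2$ and $\xi_1(t)=\xi_2(t)$ for all $t$ with $h_1(t)\neq0$. It is a complete separable metric space for $$d_\Gamma((h_1,\xi_1),(h_2,\xi_2))=\sup_{t\in[0,1]}d_F\big((h_1(t),\xi_1(t)),(h_2(t),\xi_2(t))\big),$$ where $d_F((r_1,x_1),(r_2,x_2))=|r_1|+|r_2|$ if $r_1r_2\le0$ or $|x_1-x_2|\ge2$, and $d_F((r_1,x_1),(r_2,x_2))=|r_1-r_2|+\min(|r_1|,|r_2|)|x_1-x_2|$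 otherwise. $\Gamma$ is a closed subset of $\Gamma_\infty$. For $\gamma=(h,\xi)$ write $\gamma(t)=(h(t),\xi(t))\in[-1,1]\times\bar\Omega$; consistently with the identification of curves, two points $(0,x)$ and $(0,y)$ of zero mass are identified. Put $\tilde\Gamma=\{(\gamma(t_0),\dots,\gamma(t_T)):\gamma\in\Gamma\}$. $\mathcal M(\Gamma)$ is the space of finite signed Borel measures on $\Gamma$, $\mathcal M^+(\Gamma)$ the non-negative ones. For $\sigma\in\mathcal M(\Gamma)$ and $t\in[0,1]$, the measure $\sigma_t\in\mathcal M(\bar\Omega)$ is defined by $\int_{\bar\Omega}\psi\,d\sigma_t=\int_\Gamma h(t)\psi(\xi(t))\,d\sigma(h,\xi)$ for all $\psi\in C(\bar\Omega)$. Let $t_0,\dots,t_T\in[0,1]$ and $a_i^j\in C(\bar\Omega)$ for $i=1,\dots,m$, $j=0,\dots,T$. Define $A_j\colon\mathcal M(\bar\Omega)\to\mathbb R^m$ by $(A_j\rho)_i=\int_{\bar\Omega}a_i^j\,d\rho$. Let $\mathrm F_j\in C^2(\mathbb R^m;[0,+\infty))$ be convex, and put $\mathrm F(\sigma)=\sum_{j=0}^T\mathrm F_j(A_j\sigma_{t_j})$. *)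

theory Defs
  imports "HOL-Analysis.Analysis"
begin

section \<open>Points carrying a signed mass\<close>

fun mass_rel :: "real \<times> 'a \<Rightarrow> real \<times> 'a \<Rightarrow> bool" where
  "mass_rel (r, x) (s, y) \<longleftrightarrow> r = s \<and> (r \<noteq> 0 \<longrightarrow> x = y)"

text \<open>The mass points \<open>(0, x)\<close> and \<open>(0, y)\<close> are identified.\<close>

quotient_type 'a mass_point = "real \<times> 'a" / mass_rel
  by (rule equivpI) (auto simp: reflp_def symp_def transp_def)

text \<open>On all of \<open>\<real> \<times> X\<close>, and not only on \<open>[-1,1] \<times> X\<close>, this is a metric up to the
  identification above, so that the type of mass points becomes a metric space.\<close>

fun d_F :: "real \<times> 'a::metric_space \<Rightarrow> real \<times> 'a \<Rightarrow> real" where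
  "d_F (r1, x1) (r2, x2) =
     (if r1 * r2 \<le> 0 \<or> dist x1 x2 \<ge> 2 then \<bar>r1\<bar> + \<bar>r2\<bar>
      else \<bar>r1 - r2\<bar> + min (\<bar>r1\<bar>) (\<bar>r2\<bar>) * dist x1 x2)"


lemma d_F_refl: "mass_rel p q \<Longrightarrow> d_F p q = 0"
  by (cases p; cases q) (auto simp: mult_le_0_iff)

lemma d_F_eq_0D: "d_F p q = 0 \<Longrightarrow> mass_rel p q"
proof (cases p; cases q)
  fix r x s y assume p: "p = (r, x)" "q = (s, y)" and 0: "d_F p q = 0"
  show "mass_rel p q"
  proof (cases "r * s \<le> 0 \<or> dist x y \<ge> 2")
    case True
    with 0 p have "\<bar>r\<bar> + \<bar>s\<bar> = 0" by simp
    then have "r = 0" "s = 0" by linarith+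
    then show ?thesis by (simp add: p)
  next
    case False
    with 0 p have e: "\<bar>r - s\<bar> + min (\<bar>r\<bar>) (\<bar>s\<bar>) * dist x y = 0" by simp
    have "0 \<le> min (\<bar>r\<bar>) (\<bar>s\<bar>) * dist x y" by simp
    with e have "r = s" "min (\<bar>r\<bar>) (\<bar>s\<bar>) * dist x y = 0" by linarith+
    then show ?thesis by (auto simp: p)
  qed
qed

lemma d_F_commute: "d_F p q = d_F q p"
  by (cases p; cases q) (simp add: dist_commute mult.commute min.commute abs_minus_commute)

lemma d_F_eq_min:
  "d_F (r, x) (s, y) = (if r * s \<le> 0 then \<bar>r\<bar> + \<bar>s\<bar> else \<bar>r - s\<bar> + min (\<bar>r\<bar>) (\<bar>s\<bar>) * min 2 (dist x y))"
  by (auto simp: min_def abs_if mult_le_0_iff not_le zero_less_mult_iff)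

lemma d_F_triangle: "d_F p q \<le> d_F p o' + d_F o' q"
proof (cases p; cases q; cases o')
  fix r x s y u z assume p: "p = (r, x)" "q = (s, y)" "o' = (u, z)"
  define a where "a = min 2 (dist x y)"
  define b where "b = min 2 (dist x z)"
  define c where "c = min 2 (dist z y)"
  have "dist x y \<le> dist x z + dist z y" by (rule dist_triangle)
  then have abc: "a \<le> b + c" "0 \<le> a" "a \<le> 2" "0 \<le> b" "b \<le> 2" "0 \<le> c" "c \<le> 2"
    using zero_le_dist[of x z] zero_le_dist[of z y] unfolding a_def b_def c_def min_def
    by (simp_all, linarith)
  have core: "\<bar>r' - s'\<bar> + min r' s' * a' \<le> (\<bar>r' - u'\<bar> + min r' u' * b') + (\<bar>u' - s'\<bar> + min u' s' * c')"
    if "0 < r'" "0 < s'" "0 < u'" "a' \<le> b' + c'" "a' \<le> 2" "0 \<le> b'" "0 \<le> c'" for r' s' u' a' b' c' :: real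
  proof (cases "min r' s' \<le> u'")
    case True
    have "min r' s' * a' \<le> min r' s' * (b' + c')" using that by (intro mult_left_mono) auto
    also have "\<dots> \<le> min r' u' * b' + min u' s' * c'"
      using that True by (auto simp: distrib_left intro!: add_mono mult_right_mono)
    finally show ?thesis by linarith
  next
    case False
    then have "min r' u' = u'" "min u' s' = u'" by auto
    have "(min r' s' - u') * a' \<le> (min r' s' - u') * 2" using that False by (intro mult_left_mono) auto
    moreover have "u' * a' \<le> u' * (b' + c')" using that by (intro mult_left_mono) auto
    ultimately have "min r' s' * a' \<le> 2 * (min r' s' - u') + (u' * b' + u' * c')"
      by (simp add: algebra_simps)
    moreover have "\<bar>r' - s'\<bar> + 2 * (min r' s' - u') = \<bar>r' - u'\<bar> + \<bar>u' - s'\<bar>" using False by auto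
    ultimately show ?thesis unfolding \<open>min r' u' = u'\<close> \<open>min u' s' = u'\<close> by linarith
  qed
  have le: "\<bar>v\<bar> - \<bar>v'\<bar> \<le> \<bar>v - v'\<bar> + min (\<bar>v\<bar>) (\<bar>v'\<bar>) * d"
    "\<bar>v'\<bar> - \<bar>v\<bar> \<le> \<bar>v - v'\<bar> + min (\<bar>v\<bar>) (\<bar>v'\<bar>) * d" if "0 \<le> d" for v v' d :: real
    using mult_nonneg_nonneg[of "min (\<bar>v\<bar>) (\<bar>v'\<bar>)" d] that by linarith+
  have le': "\<bar>v - v'\<bar> + min (\<bar>v\<bar>) (\<bar>v'\<bar>) * d \<le> \<bar>v\<bar> + \<bar>v'\<bar>" if "0 < v * v'" "d \<le> 2" for v v' d :: real
  proof -
    have "min (\<bar>v\<bar>) (\<bar>v'\<bar>) * d \<le> min (\<bar>v\<bar>) (\<bar>v'\<bar>) * 2" using that by (intro mult_left_mono) auto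
    then show ?thesis using that by (auto simp: zero_less_mult_iff min_def abs_if split: if_splits)
  qed
  have dF: "d_F p q = (if r * s \<le> 0 then \<bar>r\<bar> + \<bar>s\<bar> else \<bar>r - s\<bar> + min (\<bar>r\<bar>) (\<bar>s\<bar>) * a)"
    "d_F p o' = (if r * u \<le> 0 then \<bar>r\<bar> + \<bar>u\<bar> else \<bar>r - u\<bar> + min (\<bar>r\<bar>) (\<bar>u\<bar>) * b)"
    "d_F o' q = (if u * s \<le> 0 then \<bar>u\<bar> + \<bar>s\<bar> else \<bar>u - s\<bar> + min (\<bar>u\<bar>) (\<bar>s\<bar>) * c)"
    unfolding p a_def b_def c_def by (rule d_F_eq_min)+
  consider "u = 0" | "u \<noteq> 0" "r * s \<le> 0" | "u \<noteq> 0" "0 < r * s" by linarith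
  then show "d_F p q \<le> d_F p o' + d_F o' q"
  proof cases
    case 1
    then show ?thesis using le'[of r s a] abc by (auto simp: dF)
  next
    case 2
    have "r * u \<le> 0 \<or> u * s \<le> 0" using 2 by (auto simp: mult_le_0_iff)
    then have "d_F p o' = \<bar>r\<bar> + \<bar>u\<bar> \<or> d_F o' q = \<bar>u\<bar> + \<bar>s\<bar>" using dF(2,3) by presburger
    moreover have "d_F p q = \<bar>r\<bar> + \<bar>s\<bar>" using 2 dF(1) by presburger
    moreover have "\<bar>r\<bar> - \<bar>u\<bar> \<le> d_F p o'"
      unfolding dF(2) using le(1)[where d = b and v = r and v' = u, OF abc(4)] by simp
    moreover have "\<bar>s\<bar> - \<bar>u\<bar> \<le> d_F o' q"
      unfolding dF(3) using le(2)[where d = c and v = u and v' = s, OF abc(6)] by simp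
    ultimately show ?thesis by linarith
  next
    case 3
    show ?thesis
    proof (cases "0 < r * u")
      case True
      then have e: "\<bar>\<bar>r\<bar> - \<bar>s\<bar>\<bar> = \<bar>r - s\<bar>" "\<bar>\<bar>r\<bar> - \<bar>u\<bar>\<bar> = \<bar>r - u\<bar>" "\<bar>\<bar>u\<bar> - \<bar>s\<bar>\<bar> = \<bar>u - s\<bar>"
        and us: "\<not> u * s \<le> 0" and pos: "0 < \<bar>r\<bar>" "0 < \<bar>s\<bar>" "0 < \<bar>u\<bar>"
        using 3 by (auto simp: zero_less_mult_iff mult_le_0_iff)
      have "\<not> r * s \<le> 0" "\<not> r * u \<le> 0" using 3 True by auto
      then show ?thesis
        using core[OF pos abc(1,3,4,6), unfolded e] dF us by presburger
    next
      case False
      then have "r * u \<le> 0" "u * s \<le> 0" using 3 by (auto simp: zero_less_mult_iff mult_le_0_iff)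
      moreover have "\<not> r * s \<le> 0" using 3 by simp
      moreover note le'[of r s a, OF 3(2) abc(3)]
      moreover have "0 \<le> \<bar>u\<bar>" by simp
      ultimately have "d_F p q \<le> \<bar>r\<bar> + \<bar>s\<bar>" "d_F p o' = \<bar>r\<bar> + \<bar>u\<bar>" "d_F o' q = \<bar>u\<bar> + \<bar>s\<bar>"
        by (simp_all only: dF if_True if_False)
      with \<open>0 \<le> \<bar>u\<bar>\<close> show ?thesis by linarith
    qed
  qed
qed

instantiation mass_point :: (metric_space) metric_space
begin

lift_definition dist_mass_point :: "'a mass_point \<Rightarrow> 'a mass_point \<Rightarrow> real" is d_F
  by (force simp: mult_le_0_iff)

definition uniformity_mass_point :: "('a mass_point \<times> 'a mass_point) filter" where
  "uniformity_mass_point = (INF e\<in>{0<..}. principal {(x, y). dist x y < e})"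

definition open_mass_point :: "'a mass_point set \<Rightarrow> bool" where
  "open_mass_point U \<longleftrightarrow> (\<forall>x\<in>U. eventually (\<lambda>(x', y). x' = x \<longrightarrow> y \<in> U) uniformity)"

instance
proof
  show "(dist x y = 0) = (x = y)" for x y :: "'a mass_point"
    by transfer (use d_F_refl d_F_eq_0D in blast)
  show "dist x y \<le> dist x z + dist y z" for x y z :: "'a mass_point"
    by transfer (use d_F_triangle d_F_commute in metis)
qed (fact uniformity_mass_point_def open_mass_point_def)+

end

section \<open>Curves\<close>

text \<open>A curve is a class of pairs of functions on the whole real line, of which only the
  restrictions to \<open>[0,1]\<close> matter: two pairs are identified iff for all \<open>t \<in> [0,1]\<close> the heights
  agree and, where these do not vanish, the positions agree.\<close>

fun curve_pair :: "(real \<Rightarrow> real) \<times> (real \<Rightarrow> 'a::topological_space) \<Rightarrow> bool" where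
  "curve_pair (h, \<xi>) \<longleftrightarrow>
     continuous_on {0..1} h \<and> h ` {0..1} \<subseteq> {-1..1} \<and> continuous_on {t \<in> {0..1}. h t \<noteq> 0} \<xi>"

definition curve_rel ::
  "(real \<Rightarrow> real) \<times> (real \<Rightarrow> 'a::topological_space) \<Rightarrow> (real \<Rightarrow> real) \<times> (real \<Rightarrow> 'a) \<Rightarrow> bool" where
  "curve_rel c d \<longleftrightarrow> curve_pair c \<and> curve_pair d \<and>
     (\<forall>t\<in>{0..1}. mass_rel (fst c t, snd c t) (fst d t, snd d t))"

quotient_type (overloaded) 'a curve = "(real \<Rightarrow> real) \<times> (real \<Rightarrow> 'a::topological_space)" / partial: curve_rel
proof (rule part_equivpI)
  show "\<exists>x. curve_rel x x"
    by (rule exI[of _ "(\<lambda>_. 0, \<lambda>_. undefined)"]) (auto simp: curve_rel_def)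
qed (auto simp: curve_rel_def symp_def transp_def)

text \<open>The point \<open>\<gamma>(t) = (h(t), \<xi>(t))\<close>; outside \<open>[0,1]\<close> it is set to the point of zero mass.\<close>

lift_definition eval :: "'a::topological_space curve \<Rightarrow> real \<Rightarrow> 'a mass_point" is
  "\<lambda>(h, \<xi>) t. if t \<in> {0..1} then (h t, \<xi> t) else (0, undefined)"
  by (auto simp: curve_rel_def)

lemma eval_eqI: "(\<And>t. t \<in> {0..1} \<Longrightarrow> eval c t = eval d t) \<Longrightarrow> c = d"
  by transfer (auto simp: curve_rel_def split: if_splits)

lift_definition mass :: "'a mass_point \<Rightarrow> real" is fst
  by auto

lemma mass_eval_bounded: "\<bar>mass (eval c t)\<bar> \<le> 1"
  by transfer (force simp: curve_rel_def abs_le_iff image_subset_iff)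

lemma dist_mass_le: "\<bar>mass p - mass q\<bar> \<le> dist p q"
  by transfer auto

lemma dist_le_mass: "dist p q \<le> \<bar>mass p\<bar> + \<bar>mass q\<bar>"
proof transfer
  fix p q :: "real \<times> 'a" 
  obtain r x s y where p: "p = (r, x)" "q = (s, y)" by fastforce
  have "min (\<bar>r\<bar>) (\<bar>s\<bar>) * min 2 (dist x y) \<le> min (\<bar>r\<bar>) (\<bar>s\<bar>) * 2" by (intro mult_left_mono) auto
  then show "d_F p q \<le> \<bar>fst p\<bar> + \<bar>fst q\<bar>"
    by (auto simp: p d_F_eq_min abs_if min_def mult_le_0_iff split: if_splits)
qed

lemma bdd_above_dist_eval: "bdd_above ((\<lambda>t. dist (eval c t) (eval d t)) ` {0..1})"
proof (rule bdd_aboveI2)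
  fix t show "dist (eval c t) (eval d t) \<le> 2"
    using dist_le_mass[of "eval c t" "eval d t"] mass_eval_bounded[of c t] mass_eval_bounded[of d t]
    by linarith
qed

instantiation curve :: (metric_space) metric_space
begin

definition dist_curve :: "'a curve \<Rightarrow> 'a curve \<Rightarrow> real" where
  "dist_curve c d = (SUP t\<in>{0..1}. dist (eval c t) (eval d t))"

definition uniformity_curve :: "('a curve \<times> 'a curve) filter" where
  "uniformity_curve = (INF e\<in>{0<..}. principal {(x, y). dist x y < e})"

definition open_curve :: "'a curve set \<Rightarrow> bool" where
  "open_curve U \<longleftrightarrow> (\<forall>x\<in>U. eventually (\<lambda>(x', y). x' = x \<longrightarrow> y \<in> U) uniformity)"

instance
proof
  have ge: "dist (eval c t) (eval d t) \<le> dist c d" if "t \<in> {0..1}" for c d :: "'a curve" and t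
    unfolding dist_curve_def by (rule cSUP_upper[OF that bdd_above_dist_eval])
  show "(dist c d = 0) = (c = d)" for c d :: "'a curve"
  proof
    assume "dist c d = 0"
    then have "eval c t = eval d t" if "t \<in> {0..1}" for t
      using ge[OF that, of c d] by simp
    then show "c = d" by (rule eval_eqI)
  qed (simp add: dist_curve_def)
  show "dist c d \<le> dist c e + dist d e" for c d e :: "'a curve"
    unfolding dist_curve_def[of c d]
  proof (rule cSUP_least)
    fix t :: real assume "t \<in> {0..1}"
    then show "dist (eval c t) (eval d t) \<le> dist c e + dist d e"
      using dist_triangle2[of "eval c t" "eval d t" "eval e t"] ge[of t c e] ge[of t d e] by linarith
  qed simp
qed (fact uniformity_curve_def open_curve_def)+

end

text \<open>The curves with values in \<open>[-1,1] \<times> K\<close>.\<close>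

definition curves_in :: "'a::metric_space set \<Rightarrow> 'a curve set" where
  "curves_in K = {\<gamma>. \<exists>h \<xi>. curve_pair (h, \<xi>) \<and> \<xi> ` {0..1} \<subseteq> K \<and> \<gamma> = abs_curve (h, \<xi>)}"

section \<open>Measures\<close>

abbreviation borel_on :: "'a::topological_space set \<Rightarrow> 'a measure" where
  "borel_on S \<equiv> restrict_space borel S"

text \<open>The nonnegative finite Borel measures on \<open>S\<close>.\<close>

definition finite_borel_measures :: "'a::topological_space set \<Rightarrow> 'a measure set" where
  "finite_borel_measures S = {\<sigma>. finite_measure \<sigma> \<and> sets \<sigma> = sets (borel_on S)}"

definition measure_support :: "'a::topological_space measure \<Rightarrow> 'a set" where
  "measure_support M = {x \<in> space M. \<forall>U. open U \<longrightarrow> x \<in> U \<longrightarrow> 0 < emeasure M (U \<inter> space M)}"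

text \<open>Finite signed measures on the measurable space underlying \<open>M\<close>, as countably additive
  real-valued set functions; they are set to \<open>0\<close> on nonmeasurable sets so that equality of signed
  measures is equality of functions. Countable additivity for the constant sequence \<open>{}\<close> forces
  \<open>\<mu> {} = 0\<close>.\<close>

definition signed_measures :: "'a measure \<Rightarrow> ('a set \<Rightarrow> real) set" where
  "signed_measures M = {\<mu>. (\<forall>A. A \<notin> sets M \<longrightarrow> \<mu> A = 0) \<and>
     (\<forall>A :: nat \<Rightarrow> 'a set. range A \<subseteq> sets M \<longrightarrow> disjoint_family A \<longrightarrow> (\<lambda>n. \<mu> (A n)) sums \<mu> (\<Union>n. A n))}"

text \<open>The positive part of the Jordan decomposition, \<open>\<mu>\<^sup>+(A) = sup {\<mu>(B) | B \<subseteq> A}\<close>; the coercion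
  to \<open>ennreal\<close> truncates negative values to \<open>0\<close>, which does not affect the supremum. The negative
  part is \<open>(-\<mu>)\<^sup>+\<close>.\<close>

definition pos_variation :: "'a measure \<Rightarrow> ('a set \<Rightarrow> real) \<Rightarrow> 'a measure" where
  "pos_variation M \<mu> =
     measure_of (space M) (sets M) (\<lambda>A. SUP B\<in>{B \<in> sets M. B \<subseteq> A}. ennreal (\<mu> B))"

definition signed_integral :: "'a measure \<Rightarrow> ('a set \<Rightarrow> real) \<Rightarrow> ('a \<Rightarrow> real) \<Rightarrow> real" where
  "signed_integral M \<mu> \<psi> =
     (\<integral>x. \<psi> x \<partial>pos_variation M \<mu>) - (\<integral>x. \<psi> x \<partial>pos_variation M (\<lambda>A. - \<mu> A))"

text \<open>For \<open>\<gamma> = (h, \<xi>)\<close> the number \<open>weighted \<psi> (eval \<gamma> t)\<close> is \<open>h(t) \<psi>(\<xi>(t))\<close>.\<close>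

lift_definition weighted :: "('a \<Rightarrow> real) \<Rightarrow> 'a mass_point \<Rightarrow> real" is "\<lambda>\<psi> (r, x). r * \<psi> x"
  by auto

text \<open>The measure \<open>\<sigma>\<^sub>t\<close> on \<open>K\<close>. Existence and uniqueness are shown in \<open>slice_exists_unique\<close>
  below.\<close>

definition slice :: "'a::metric_space set \<Rightarrow> 'a curve measure \<Rightarrow> real \<Rightarrow> ('a set \<Rightarrow> real)" where
  "slice K \<sigma> t = (THE \<rho>. \<rho> \<in> signed_measures (borel_on K) \<and>
     (\<forall>\<psi>. continuous_on K \<psi> \<longrightarrow>
        signed_integral (borel_on K) \<rho> \<psi> = (\<integral>\<gamma>. weighted \<psi> (eval \<gamma> t) \<partial>\<sigma>)))"

section \<open>The variational problem\<close>

definition twice_continuously_differentiable ::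
  "('a::real_normed_vector \<Rightarrow> 'b::real_normed_vector) \<Rightarrow> bool" where
  "twice_continuously_differentiable f \<longleftrightarrow>
     (\<exists>(f' :: 'a \<Rightarrow> 'a \<Rightarrow>\<^sub>L 'b) (f'' :: 'a \<Rightarrow> 'a \<Rightarrow>\<^sub>L ('a \<Rightarrow>\<^sub>L 'b)).
        (\<forall>x. (f has_derivative blinfun_apply (f' x)) (at x)) \<and>
        (\<forall>x. (f' has_derivative blinfun_apply (f'' x)) (at x)) \<and>
        continuous_on UNIV f'')"

definition lower_semicontinuous_on ::
  "'a::topological_space set \<Rightarrow> ('a \<Rightarrow> 'b::linorder) \<Rightarrow> bool" where
  "lower_semicontinuous_on S f \<longleftrightarrow>
     (\<forall>x\<in>S. \<forall>c < f x. eventually (\<lambda>y. c < f y) (at x within S))"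

text \<open>The operator \<open>A\<^sub>j\<close> for the coefficient functions \<open>a = a\<^sup>j\<close>.\<close>

definition moments ::
  "'a::metric_space set \<Rightarrow> ('m::finite \<Rightarrow> 'a \<Rightarrow> real) \<Rightarrow> ('a set \<Rightarrow> real) \<Rightarrow> real ^ 'm" where
  "moments K a \<rho> = (\<chi> i. signed_integral (borel_on K) \<rho> (a i))"

definition data_term ::
  "'a::metric_space set \<Rightarrow> nat \<Rightarrow> (nat \<Rightarrow> real) \<Rightarrow> (nat \<Rightarrow> 'm::finite \<Rightarrow> 'a \<Rightarrow> real) \<Rightarrow>
   (nat \<Rightarrow> real ^ 'm \<Rightarrow> real) \<Rightarrow> 'a curve measure \<Rightarrow> real" where
  "data_term K T t a F \<sigma> = (\<Sum>j\<le>T. F j (moments K (a j) (slice K \<sigma> (t j))))"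

definition energy ::
  "'a::metric_space set \<Rightarrow> nat \<Rightarrow> (nat \<Rightarrow> real) \<Rightarrow> (nat \<Rightarrow> 'm::finite \<Rightarrow> 'a \<Rightarrow> real) \<Rightarrow>
   (nat \<Rightarrow> real ^ 'm \<Rightarrow> real) \<Rightarrow> ('a curve \<Rightarrow> ennreal) \<Rightarrow> 'a curve measure \<Rightarrow> ennreal" where
  "energy K T t a F w \<sigma> = ennreal (data_term K T t a F \<sigma>) + (\<integral>\<^sup>+\<gamma>. w \<gamma> \<partial>\<sigma>)"

text \<open>Only the values \<open>p 0, \<dots>, p T\<close> of the sequence of mass points matter.\<close>

definition optimal_curves ::
  "'a::metric_space curve set \<Rightarrow> nat \<Rightarrow> (nat \<Rightarrow> real) \<Rightarrow> ('a curve \<Rightarrow> ennreal) \<Rightarrow>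
   (nat \<Rightarrow> 'a mass_point) \<Rightarrow> 'a curve set" where
  "optimal_curves \<Gamma> T t w p =
     {\<gamma>. is_arg_min w (\<lambda>\<gamma>. \<gamma> \<in> \<Gamma> \<and> (\<forall>j\<le>T. eval \<gamma> (t j) = p j) \<and> w \<gamma> < \<infinity>) \<gamma>}"

section \<open>The Jordan decomposition\<close>

lemma signed_measuresD:
  assumes "\<mu> \<in> signed_measures M"
  shows signed_measure_sums: "\<And>A :: nat \<Rightarrow> 'a set. range A \<subseteq> sets M \<Longrightarrow> disjoint_family A \<Longrightarrow> (\<lambda>n. \<mu> (A n)) sums \<mu> (\<Union>n. A n)"
    and signed_measure_empty: "\<mu> {} = 0"
    and signed_measure_Un: "\<And>A B. A \<in> sets M \<Longrightarrow> B \<in> sets M \<Longrightarrow> A \<inter> B = {} \<Longrightarrow> \<mu> (A \<union> B) = \<mu> A + \<mu> B"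
    and signed_measure_uminus: "(\<lambda>A. - \<mu> A) \<in> signed_measures M"
proof -
  show s: "(\<lambda>n. \<mu> (A n)) sums \<mu> (\<Union>n. A n)" if "range A \<subseteq> sets M" "disjoint_family A" for A :: "nat \<Rightarrow> 'a set"
    using assms that by (simp add: signed_measures_def)
  have "(\<lambda>n. \<mu> {}) sums \<mu> {}"
    using s[of "\<lambda>_. {}"] by (simp add: disjoint_family_on_def)
  then have "(\<lambda>n::nat. \<mu> {}) \<longlonglongrightarrow> 0"
    using sums_summable summable_LIMSEQ_zero by blast
  then show e: "\<mu> {} = 0" by (simp add: LIMSEQ_const_iff)
  show "\<mu> (A \<union> B) = \<mu> A + \<mu> B" if "A \<in> sets M" "B \<in> sets M" "A \<inter> B = {}" for A B
  proof -
    have disj: "disjoint_family (binaryset A B)"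
      using that by (auto simp: disjoint_family_on_def binaryset_def)
    have "(\<lambda>n. \<mu> (binaryset A B n)) sums \<mu> (A \<union> B)"
      using s[of "binaryset A B", unfolded range_binaryset_eq UN_binaryset_eq] that
      by (simp add: disj)
    moreover have "(\<lambda>n. \<mu> (binaryset A B n)) sums (\<mu> A + \<mu> B)"
      by (rule binaryset_sums[of \<mu>, OF e])
    ultimately show ?thesis by (rule sums_unique2)
  qed
  show "(\<lambda>A. - \<mu> A) \<in> signed_measures M"
    using assms by (auto simp: signed_measures_def intro: sums_minus)
qed

lemma signed_measure_Diff:
  assumes "\<mu> \<in> signed_measures M" "A \<in> sets M" "B \<in> sets M" "B \<subseteq> A"
  shows "\<mu> (A - B) = \<mu> A - \<mu> B"
  using signed_measure_Un[OF assms(1), of B "A - B"] assms by (auto simp: Un_absorb1)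

lemma signed_measure_bounded:
  assumes \<mu>: "\<mu> \<in> signed_measures M"
  obtains K where "\<And>B. B \<in> sets M \<Longrightarrow> \<bar>\<mu> B\<bar> \<le> K"
proof -
  define bad where "bad A \<longleftrightarrow> A \<in> sets M \<and> (\<forall>K. \<exists>B\<in>sets M. B \<subseteq> A \<and> \<bar>\<mu> B\<bar> > K)" for A
  have step: "\<exists>B. bad B \<and> B \<subseteq> A \<and> 1 \<le> \<bar>\<mu> (A - B)\<bar>" if badA: "bad A" for A
  proof -
    have A: "A \<in> sets M" using that by (simp add: bad_def)
    obtain C where C: "C \<in> sets M" "C \<subseteq> A" "\<bar>\<mu> C\<bar> > 1 + \<bar>\<mu> A\<bar>"
      using badA[unfolded bad_def, THEN conjunct2, rule_format, of "1 + \<bar>\<mu> A\<bar>"] by metis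
    have d: "\<mu> (A - C) = \<mu> A - \<mu> C" using signed_measure_Diff[OF \<mu> A] C by auto
    have AAC: "A - (A - C) = C" using C by auto
    show ?thesis
    proof (cases "bad C")
      case True
      then show ?thesis using C d by (intro exI[of _ C]) auto
    next
      case nC: False
      then obtain K where K: "\<And>B. B \<in> sets M \<Longrightarrow> B \<subseteq> C \<Longrightarrow> \<bar>\<mu> B\<bar> \<le> K"
        using C(1) unfolding bad_def not_le[symmetric] by metis
      have "bad (A - C)"
      proof (rule ccontr)
        assume "\<not> bad (A - C)"
        then obtain L where L: "\<And>B. B \<in> sets M \<Longrightarrow> B \<subseteq> A - C \<Longrightarrow> \<bar>\<mu> B\<bar> \<le> L"
          using sets.Diff[OF A C(1)] unfolding bad_def not_le[symmetric] by metis
        have "\<bar>\<mu> B\<bar> \<le> K + L" if B: "B \<in> sets M" "B \<subseteq> A" for B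
        proof -
          have "\<mu> B = \<mu> (B \<inter> C) + \<mu> (B - C)"
            using signed_measure_Un[OF \<mu>, of "B \<inter> C" "B - C"] B C by (auto simp: Int_Diff_Un)
          moreover have "\<bar>\<mu> (B \<inter> C)\<bar> \<le> K" using B C by (intro K) auto
          moreover have "\<bar>\<mu> (B - C)\<bar> \<le> L" using B C by (intro L) auto
          ultimately show ?thesis by linarith
        qed
        then show False using badA unfolding bad_def not_le[symmetric] by metis
      qed
      then show ?thesis using C by (intro exI[of _ "A - C"]) (auto simp: AAC)
    qed
  qed
  have "\<not> bad (space M)"
  proof
    assume "bad (space M)"
    then obtain A where A: "\<And>n::nat. bad (A n) \<and> A (Suc n) \<subseteq> A n \<and> 1 \<le> \<bar>\<mu> (A n - A (Suc n))\<bar>"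
      using dependent_nat_choice[of "\<lambda>_. bad" "\<lambda>_ A B. B \<subseteq> A \<and> 1 \<le> \<bar>\<mu> (A - B)\<bar>"] step by metis
    define D where "D n = A n - A (Suc n)" for n
    have dec: "decseq A" using A by (intro decseq_SucI) auto
    have "disjoint_family D"
    proof -
      have lt: "D m \<inter> D n = {}" if "m < n" for m n
        using decseqD[OF dec, of "Suc m" n] that by (auto simp: D_def)
      then show ?thesis unfolding disjoint_family_on_def by (metis Int_commute linorder_neq_iff)
    qed
    moreover have "range D \<subseteq> sets M" using A by (auto simp: D_def bad_def)
    ultimately have "(\<lambda>n. \<mu> (D n)) sums \<mu> (\<Union>n. D n)" by (intro signed_measure_sums[OF \<mu>])
    then have "(\<lambda>n. \<mu> (D n)) \<longlonglongrightarrow> 0" using sums_summable summable_LIMSEQ_zero by blast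
    then have "(\<lambda>n. \<bar>\<mu> (D n)\<bar>) \<longlonglongrightarrow> 0" by (rule tendsto_rabs_zero)
    then have "1 \<le> (0::real)"
      by (rule LIMSEQ_le_const) (use A in \<open>auto simp: D_def\<close>)
    then show False by simp
  qed
  then show thesis using that sets.sets_into_space unfolding bad_def not_le[symmetric] by (metis sets.top)
qed

lemma
  assumes \<mu>: "\<mu> \<in> signed_measures M"
  shows sets_pos_variation [simp]: "sets (pos_variation M \<mu>) = sets M"
    and space_pos_variation [simp]: "space (pos_variation M \<mu>) = space M"
    and emeasure_pos_variation: "A \<in> sets M \<Longrightarrow>
      emeasure (pos_variation M \<mu>) A = (SUP B\<in>{B \<in> sets M. B \<subseteq> A}. ennreal (\<mu> B))"
    and finite_measure_pos_variation: "finite_measure (pos_variation M \<mu>)"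
proof -
  define v where "v A = (SUP B\<in>{B \<in> sets M. B \<subseteq> A}. ennreal (\<mu> B))" for A
  show s: "sets (pos_variation M \<mu>) = sets M" and sp: "space (pos_variation M \<mu>) = space M"
    by (auto simp: pos_variation_def)
  have v_upper: "ennreal (\<mu> B) \<le> v A" if "B \<in> sets M" "B \<subseteq> A" for A B
    unfolding v_def using that by (intro SUP_upper) auto
  have v_empty: "v {} = 0"
    unfolding v_def by (rule antisym) (auto intro!: SUP_least simp: signed_measure_empty[OF \<mu>])
  have v_mono: "v A \<le> v B" if "A \<subseteq> B" for A B
    unfolding v_def using that by (intro SUP_subset_mono) auto
  have v_Un: "v A + v B \<le> v (A \<union> B)" if d: "A \<inter> B = {}" for A B
  proof -
    have key: "ennreal (\<mu> C) + ennreal (\<mu> D) \<le> v (A \<union> B)"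
      if "C \<in> sets M" "C \<subseteq> A" "D \<in> sets M" "D \<subseteq> B" for C D
    proof -
      consider "\<mu> C \<le> 0" | "\<mu> D \<le> 0" | "0 \<le> \<mu> C" "0 \<le> \<mu> D" by linarith
      then show ?thesis
      proof cases
        case 1 then show ?thesis using v_upper[of D "A \<union> B"] that by (auto simp: ennreal_neg)
      next
        case 2 then show ?thesis using v_upper[of C "A \<union> B"] that by (auto simp: ennreal_neg)
      next
        case 3
        have "C \<inter> D = {}" "C \<union> D \<subseteq> A \<union> B" using that d by auto
        then have "ennreal (\<mu> C + \<mu> D) \<le> v (A \<union> B)"
          using v_upper[of "C \<union> D" "A \<union> B"] that signed_measure_Un[OF \<mu>, of C D] by auto
        then show ?thesis using 3 by simp
      qed
    qed
    have ne: "{B \<in> sets M. B \<subseteq> A} \<noteq> {}" for A by auto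
    have "v A + ennreal (\<mu> D) \<le> v (A \<union> B)" if "D \<in> sets M" "D \<subseteq> B" for D
      unfolding v_def[of A] ennreal_SUP_add_left[OF ne, symmetric]
      using key that by (intro SUP_least) auto
    then show ?thesis
      unfolding v_def[of B] add.commute[of "v A"] ennreal_SUP_add_left[OF ne, symmetric]
      by (intro SUP_least) (auto simp: add.commute[of _ "v A"])
  qed
  have v_sum: "(\<Sum>i<n. v (A i)) \<le> v (\<Union>i<n. A i)" if d: "disjoint_family A" for A :: "nat \<Rightarrow> 'a set" and n
  proof (induction n)
    case 0 then show ?case by simp
  next
    case (Suc n)
    have "A i \<inter> A n = {}" if "i < n" for i
      using disjoint_family_onD[OF d, of i n] that by simp
    then have "(\<Union>i<n. A i) \<inter> A n = {}" by blast
    then have "v (\<Union>i<n. A i) + v (A n) \<le> v ((\<Union>i<n. A i) \<union> A n)" by (rule v_Un)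
    also have "(\<Union>i<n. A i) \<union> A n = (\<Union>i<Suc n. A i)" by (auto simp: lessThan_Suc)
    finally show ?case
      unfolding sum.lessThan_Suc using add_right_mono[OF Suc.IH] by (rule order_trans[rotated])
  qed
  have ca: "countably_additive (sets M) v"
    unfolding countably_additive_def
  proof (intro allI impI antisym)
    fix A :: "nat \<Rightarrow> 'a set"
    assume A: "range A \<subseteq> sets M" "disjoint_family A"
    show "(\<Sum>i. v (A i)) \<le> v (\<Union>i. A i)"
      unfolding suminf_eq_SUP
      by (intro SUP_least order_trans[OF v_sum[OF A(2)]] v_mono) auto
    show "v (\<Union>i. A i) \<le> (\<Sum>i. v (A i))"
      unfolding v_def[of "\<Union>i. A i"]
    proof (rule SUP_least, clarsimp)
      fix B assume B: "B \<in> sets M" "B \<subseteq> (\<Union>i. A i)"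
      have "(\<lambda>n. \<mu> (B \<inter> A n)) sums \<mu> (\<Union>n. B \<inter> A n)"
        using A B by (intro signed_measure_sums[OF \<mu>]) (auto simp: disjoint_family_on_def)
      moreover have "(\<Union>n. B \<inter> A n) = B" using B by auto
      ultimately have "(\<lambda>n. \<Sum>i<n. \<mu> (B \<inter> A i)) \<longlonglongrightarrow> \<mu> B" by (simp add: sums_def)
      then have "(\<lambda>n. ennreal (\<Sum>i<n. \<mu> (B \<inter> A i))) \<longlonglongrightarrow> ennreal (\<mu> B)" by (rule tendsto_ennrealI)
      then show "ennreal (\<mu> B) \<le> (\<Sum>i. v (A i))"
      proof (rule LIMSEQ_le_const2, intro exI allI impI)
        fix n
        have "ennreal (\<Sum>i<n. \<mu> (B \<inter> A i)) \<le> ennreal (\<Sum>i<n. max 0 (\<mu> (B \<inter> A i)))"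
          by (intro ennreal_leI sum_mono) auto
        also have "\<dots> = (\<Sum>i<n. ennreal (max 0 (\<mu> (B \<inter> A i))))" by (rule sum_ennreal[symmetric]) auto
        also have "\<dots> \<le> (\<Sum>i<n. v (A i))"
        proof (rule sum_mono)
          fix i
          have "ennreal (max 0 (\<mu> (B \<inter> A i))) = ennreal (\<mu> (B \<inter> A i))"
            by (auto simp: max_def ennreal_neg)
          also have "\<dots> \<le> v (A i)" using A B by (intro v_upper) auto
          finally show "ennreal (max 0 (\<mu> (B \<inter> A i))) \<le> v (A i)" .
        qed
        also have "\<dots> \<le> (\<Sum>i. v (A i))" by (rule sum_le_suminf) auto
        finally show "ennreal (\<Sum>i<n. \<mu> (B \<inter> A i)) \<le> (\<Sum>i. v (A i))" .
      qed
    qed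
  qed
  have em: "emeasure (pos_variation M \<mu>) A = v A" if "A \<in> sets M" for A
  proof (rule emeasure_measure_of[where \<Omega> = "space M" and A = "sets M"])
    show "pos_variation M \<mu> = measure_of (space M) (sets M) v"
      unfolding pos_variation_def v_def[abs_def] ..
    show "positive (sets (pos_variation M \<mu>)) v" using v_empty by (simp add: positive_def s)
    show "countably_additive (sets (pos_variation M \<mu>)) v" using ca by (simp add: s)
    show "sets M \<subseteq> Pow (space M)" by (rule sets.space_closed)
    show "A \<in> sets (pos_variation M \<mu>)" by (simp only: s that)
  qed
  then show "A \<in> sets M \<Longrightarrow>
      emeasure (pos_variation M \<mu>) A = (SUP B\<in>{B \<in> sets M. B \<subseteq> A}. ennreal (\<mu> B))"
    by (simp add: v_def)
  obtain K where K: "\<And>B. B \<in> sets M \<Longrightarrow> \<bar>\<mu> B\<bar> \<le> K"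
    by (rule signed_measure_bounded[OF \<mu>]) blast
  have "v (space M) \<le> ennreal K"
    unfolding v_def using K abs_le_D1 by (intro SUP_least ennreal_leI) blast
  then have "v (space M) \<noteq> \<infinity>" by (metis ennreal_neq_top infinity_ennreal_def neq_top_trans)
  then show "finite_measure (pos_variation M \<mu>)"
    by (intro finite_measureI) (simp add: sp em)
qed

lemma Jordan_decomposition:
  assumes \<mu>: "\<mu> \<in> signed_measures M" and A: "A \<in> sets M"
  shows "\<mu> A = measure (pos_variation M \<mu>) A - measure (pos_variation M (\<lambda>A. - \<mu> A)) A"
proof -
  have le: "measure (pos_variation M \<nu>) A \<le> \<nu> A + measure (pos_variation M (\<lambda>A. - \<nu> A)) A"
    if \<nu>: "\<nu> \<in> signed_measures M" for \<nu>
  proof -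
    note \<nu>' = signed_measure_uminus[OF \<nu>]
    interpret P: finite_measure "pos_variation M \<nu>" by (rule finite_measure_pos_variation[OF \<nu>])
    interpret Q: finite_measure "pos_variation M (\<lambda>A. - \<nu> A)" by (rule finite_measure_pos_variation[OF \<nu>'])
    have q: "- \<nu> C \<le> measure (pos_variation M (\<lambda>A. - \<nu> A)) A" if "C \<in> sets M" "C \<subseteq> A" for C
    proof -
      have "ennreal (- \<nu> C) \<le> emeasure (pos_variation M (\<lambda>A. - \<nu> A)) A"
        unfolding emeasure_pos_variation[OF \<nu>' A] using that by (intro SUP_upper) auto
      then show ?thesis by (simp add: Q.emeasure_eq_measure)
    qed
    have "emeasure (pos_variation M \<nu>) A \<le> ennreal (\<nu> A + measure (pos_variation M (\<lambda>A. - \<nu> A)) A)"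
      unfolding emeasure_pos_variation[OF \<nu> A]
    proof (rule SUP_least, clarsimp)
      fix B assume "B \<in> sets M" "B \<subseteq> A"
      then show "ennreal (\<nu> B) \<le> ennreal (\<nu> A + measure (pos_variation M (\<lambda>A. - \<nu> A)) A)"
        using q[of "A - B"] signed_measure_Diff[OF \<nu> A, of B] A by (intro ennreal_leI) auto
    qed
    then show ?thesis using q[of A] A by (simp add: P.emeasure_eq_measure)
  qed
  show ?thesis using le[OF \<mu>] le[OF signed_measure_uminus[OF \<mu>]] by simp
qed

lemma nn_integral_sum_eq:
  assumes s: "sets N1 = sets M" "sets N2 = sets M" "sets N3 = sets M" "sets N4 = sets M"
    and eq: "\<And>A. A \<in> sets M \<Longrightarrow> emeasure N1 A + emeasure N4 A = emeasure N2 A + emeasure N3 A"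
    and f: "f \<in> borel_measurable M"
  shows "(\<integral>\<^sup>+x. f x \<partial>N1) + (\<integral>\<^sup>+x. f x \<partial>N4) = (\<integral>\<^sup>+x. f x \<partial>N2) + (\<integral>\<^sup>+x. f x \<partial>N3)"
  using f
proof (induction rule: borel_measurable_induct)
  case (cong f g)
  have "(\<integral>\<^sup>+x. f x \<partial>N) = (\<integral>\<^sup>+x. g x \<partial>N)" if "sets N = sets M" for N
    using cong(3) sets_eq_imp_space_eq[OF that] by (intro nn_integral_cong) auto
  then show ?case using cong(4) s by metis
next
  case (set A)
  then show ?case using eq s by simp
next
  case (mult u c)
  have "(\<integral>\<^sup>+x. c * u x \<partial>N) = c * (\<integral>\<^sup>+x. u x \<partial>N)" if "sets N = sets M" for N
    using mult(2) that by (intro nn_integral_cmult) (simp cong: measurable_cong_sets)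
  then show ?case using mult(4) s by (simp flip: distrib_left)
next
  case (add u v)
  have "(\<integral>\<^sup>+x. v x + u x \<partial>N) = (\<integral>\<^sup>+x. v x \<partial>N) + (\<integral>\<^sup>+x. u x \<partial>N)" if "sets N = sets M" for N
    using add that by (intro nn_integral_add) (simp_all cong: measurable_cong_sets)
  then have "(\<integral>\<^sup>+x. v x + u x \<partial>N1) + (\<integral>\<^sup>+x. v x + u x \<partial>N4) =
      ((\<integral>\<^sup>+x. v x \<partial>N1) + (\<integral>\<^sup>+x. v x \<partial>N4)) + ((\<integral>\<^sup>+x. u x \<partial>N1) + (\<integral>\<^sup>+x. u x \<partial>N4))"
    "(\<integral>\<^sup>+x. v x + u x \<partial>N2) + (\<integral>\<^sup>+x. v x + u x \<partial>N3) =
      ((\<integral>\<^sup>+x. v x \<partial>N2) + (\<integral>\<^sup>+x. v x \<partial>N3)) + ((\<integral>\<^sup>+x. u x \<partial>N2) + (\<integral>\<^sup>+x. u x \<partial>N3))"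
    using s by (simp_all add: ac_simps)
  then show ?case using add by simp
next
  case (seq U)
  have e: "(\<integral>\<^sup>+x. (SUP i. U i) x \<partial>N) = (SUP i. \<integral>\<^sup>+x. U i x \<partial>N)" if "sets N = sets M" for N
    unfolding SUP_apply using seq that
    by (intro nn_integral_monotone_convergence_SUP) (simp_all cong: measurable_cong_sets)
  have inc: "incseq (\<lambda>i. \<integral>\<^sup>+x. U i x \<partial>N)" for N
    using seq(3) by (auto simp: incseq_def le_fun_def intro!: nn_integral_mono)
  have "(\<integral>\<^sup>+x. (SUP i. U i) x \<partial>N) + (\<integral>\<^sup>+x. (SUP i. U i) x \<partial>N') =
      (SUP i. (\<integral>\<^sup>+x. U i x \<partial>N) + (\<integral>\<^sup>+x. U i x \<partial>N'))" if "sets N = sets M" "sets N' = sets M" for N N'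
    unfolding e[OF that(1)] e[OF that(2)] by (rule ennreal_SUP_add[OF inc inc, symmetric])
  then show ?case using s by (simp add: seq.IH)
qed

lemma integral_diff_eq:
  fixes f :: "'a \<Rightarrow> real"
  assumes fin: "finite_measure N1" "finite_measure N2" "finite_measure N3" "finite_measure N4"
    and s: "sets N1 = sets M" "sets N2 = sets M" "sets N3 = sets M" "sets N4 = sets M"
    and eq: "\<And>A. A \<in> sets M \<Longrightarrow> measure N1 A - measure N3 A = measure N2 A - measure N4 A"
    and f: "f \<in> borel_measurable M" and bd: "\<And>x. x \<in> space M \<Longrightarrow> \<bar>f x\<bar> \<le> K"
  shows "(\<integral>x. f x \<partial>N1) - (\<integral>x. f x \<partial>N3) = (\<integral>x. f x \<partial>N2) - (\<integral>x. f x \<partial>N4)"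
proof -
  have em: "emeasure N1 A + emeasure N4 A = emeasure N2 A + emeasure N3 A" if "A \<in> sets M" for A
    using eq[OF that] by (simp add: finite_measure.emeasure_eq_measure[OF fin(1)]
        finite_measure.emeasure_eq_measure[OF fin(2)] finite_measure.emeasure_eq_measure[OF fin(3)]
        finite_measure.emeasure_eq_measure[OF fin(4)] flip: ennreal_plus)
  have g: "ennreal (\<integral>x. f x + K \<partial>N) = (\<integral>\<^sup>+x. ennreal (f x + K) \<partial>N)"
    and g2: "(\<integral>x. f x + K \<partial>N) = (\<integral>x. f x \<partial>N) + K * measure N (space M)"
    and g3: "0 \<le> (\<integral>x. f x + K \<partial>N)"
    if N: "finite_measure N" "sets N = sets M" for N
  proof -
    interpret finite_measure N by fact
    have sp: "space N = space M" using sets_eq_imp_space_eq[OF N(2)] .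
    have i: "integrable N f"
      using bd f N(2) sp by (intro integrable_const_bound[where B = K]) (auto cong: measurable_cong_sets)
    have nn: "AE x in N. 0 \<le> f x + K"
      using bd sp by (intro AE_I2) (force simp: abs_le_iff)
    show "ennreal (\<integral>x. f x + K \<partial>N) = (\<integral>\<^sup>+x. ennreal (f x + K) \<partial>N)"
      using i nn by (intro nn_integral_eq_integral[symmetric]) auto
    show "(\<integral>x. f x + K \<partial>N) = (\<integral>x. f x \<partial>N) + K * measure N (space M)"
      using i by (simp add: sp)
    show "0 \<le> (\<integral>x. f x + K \<partial>N)" using nn by (rule integral_nonneg_AE)
  qed
  have "(\<lambda>x. ennreal (f x + K)) \<in> borel_measurable M" using f by measurable
  from nn_integral_sum_eq[OF s em this]
  have "(\<integral>x. f x + K \<partial>N1) + (\<integral>x. f x + K \<partial>N4) = (\<integral>x. f x + K \<partial>N2) + (\<integral>x. f x + K \<partial>N3)"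
    using g[OF fin(1) s(1)] g[OF fin(2) s(2)] g[OF fin(3) s(3)] g[OF fin(4) s(4)]
      g3[OF fin(1) s(1)] g3[OF fin(2) s(2)] g3[OF fin(3) s(3)] g3[OF fin(4) s(4)]
    by (metis add_nonneg_nonneg ennreal_inj ennreal_plus)
  moreover have "K * measure N1 (space M) + K * measure N4 (space M)
      = K * measure N2 (space M) + K * measure N3 (space M)"
    using eq[OF sets.top] by (simp flip: distrib_left)
  ultimately show ?thesis
    unfolding g2[OF fin(1) s(1)] g2[OF fin(2) s(2)] g2[OF fin(3) s(3)] g2[OF fin(4) s(4)]
    by linarith
qed

lemma signed_integral_diff:
  assumes "finite_measure N1" "finite_measure N2" "sets N1 = sets M" "sets N2 = sets M"
    and \<mu>: "\<mu> \<in> signed_measures M"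
    and eq: "\<And>A. A \<in> sets M \<Longrightarrow> \<mu> A = measure N1 A - measure N2 A"
    and f: "f \<in> borel_measurable M" "\<And>x. x \<in> space M \<Longrightarrow> \<bar>f x\<bar> \<le> K"
  shows "signed_integral M \<mu> f = (\<integral>x. f x \<partial>N1) - (\<integral>x. f x \<partial>N2)"
  unfolding signed_integral_def
proof (rule integral_diff_eq)
  show "measure (pos_variation M \<mu>) A - measure (pos_variation M (\<lambda>A. - \<mu> A)) A =
      measure N1 A - measure N2 A" if "A \<in> sets M" for A
    using eq[OF that] Jordan_decomposition[OF \<mu> that] by simp
qed (use assms finite_measure_pos_variation[OF \<mu>] signed_measure_uminus[OF \<mu>]
    finite_measure_pos_variation[OF signed_measure_uminus[OF \<mu>]] in simp_all)

lemma signed_measure_eqI: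
  fixes S :: "'a::metric_space set"
  assumes \<mu>: "\<mu> \<in> signed_measures (borel_on S)" and \<nu>: "\<nu> \<in> signed_measures (borel_on S)"
    and eq: "\<And>\<psi>. continuous_on S \<psi> \<Longrightarrow> signed_integral (borel_on S) \<mu> \<psi> = signed_integral (borel_on S) \<nu> \<psi>"
  shows "\<mu> = \<nu>"
proof -
  let ?M = "borel_on S"
  have sp [simp]: "space ?M = S" by (simp add: space_restrict_space)
  have inS: "S \<inter> B \<in> sets ?M" if "B \<in> sets borel" for B
    using that by (auto simp: sets_restrict_space)
  have lim: "(\<lambda>n. signed_integral ?M \<rho> (\<lambda>x. max 0 (1 - real n * infdist x C))) \<longlonglongrightarrow> \<rho> (S \<inter> C)"
    if \<rho>: "\<rho> \<in> signed_measures ?M" and C: "closed C" "C \<noteq> {}" for \<rho> C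
  proof -
    have conv: "(\<lambda>n. \<integral>x. max 0 (1 - real n * infdist x C) \<partial>N) \<longlonglongrightarrow> measure N (S \<inter> C)"
      if N: "finite_measure N" "sets N = sets ?M" for N
    proof -
      interpret finite_measure N by fact
      have spN: "space N = S" using sets_eq_imp_space_eq[OF N(2)] by simp
      have mN: "f \<in> borel_measurable N" if "f \<in> borel_measurable borel" for f :: "'a \<Rightarrow> real"
        using that N(2) by (metis measurable_cong_sets measurable_restrict_space1)
      have inN: "S \<inter> C \<in> sets N" using inS C N by auto
      have "(\<lambda>n. \<integral>x. max 0 (1 - real n * infdist x C) \<partial>N) \<longlonglongrightarrow> (\<integral>x. indicator (S \<inter> C) x \<partial>N)"
      proof (rule integral_dominated_convergence[where w = "\<lambda>_. 1"])
        show "(\<lambda>x. max 0 (1 - real n * infdist x C)) \<in> borel_measurable N" for n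
          by (intro mN borel_measurable_continuous_onI continuous_intros)
        show "(indicator (S \<inter> C) :: 'a \<Rightarrow> real) \<in> borel_measurable N" using inN by simp
        show "AE x in N. (\<lambda>n. max 0 (1 - real n * infdist x C)) \<longlonglongrightarrow> indicator (S \<inter> C) x"
        proof (rule AE_I2)
          fix x assume x: "x \<in> space N"
          show "(\<lambda>n. max 0 (1 - real n * infdist x C)) \<longlonglongrightarrow> indicator (S \<inter> C) x"
          proof (cases "x \<in> C")
            case True then show ?thesis using x spN C by (simp add: in_closed_iff_infdist_zero)
          next
            case False
            then have pos: "0 < infdist x C" using C infdist_nonneg[of x C] by (simp add: in_closed_iff_infdist_zero less_le)
            obtain m :: nat where m: "1 / infdist x C < real m" using reals_Archimedean2 by blast
            have "max 0 (1 - real n * infdist x C) = 0" if "m \<le> n" for n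
            proof -
              have "1 \<le> real m * infdist x C" using m pos by (simp add: divide_less_eq)
              also have "\<dots> \<le> real n * infdist x C" using that pos by (intro mult_right_mono) auto
              finally show ?thesis by simp
            qed
            then have "\<forall>\<^sub>F n in sequentially. max 0 (1 - real n * infdist x C) = 0"
              by (auto simp: eventually_sequentially)
            then have "(\<lambda>n. max 0 (1 - real n * infdist x C)) \<longlonglongrightarrow> 0" by (rule tendsto_eventually)
            then show ?thesis using False by simp
          qed
        qed
        show "AE x in N. norm (max 0 (1 - real n * infdist x C)) \<le> 1" for n
          by (intro AE_I2) (auto simp: infdist_nonneg)
      qed simp
      then show ?thesis using inN spN by (simp add: Int_absorb2 Int_assoc Int_commute[of C S])
    qed
    show ?thesis
      unfolding signed_integral_def Jordan_decomposition[OF \<rho> inS[OF borel_closed[OF C(1)]]]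
      using \<rho> signed_measure_uminus[OF \<rho>]
      by (intro tendsto_diff conv finite_measure_pos_variation) auto
  qed
  have cl: "\<mu> (S \<inter> C) = \<nu> (S \<inter> C)" if "closed C" for C
  proof (cases "C = {}")
    case True then show ?thesis using signed_measure_empty[OF \<mu>] signed_measure_empty[OF \<nu>] by simp
  next
    case False
    have "signed_integral ?M \<mu> (\<lambda>x. max 0 (1 - real n * infdist x C))
        = signed_integral ?M \<nu> (\<lambda>x. max 0 (1 - real n * infdist x C))" for n
      by (intro eq continuous_intros)
    then show ?thesis using lim[OF \<mu> that False] lim[OF \<nu> that False] by (simp add: LIMSEQ_unique)
  qed
  have borel: "\<mu> (S \<inter> B) = \<nu> (S \<inter> B)" if "B \<in> sets borel" for B
  proof -
    have "Int_stable {C::'a set. closed C}" by (auto simp: Int_stable_def)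
    moreover have "{C::'a set. closed C} \<subseteq> Pow UNIV" by simp
    moreover have "B \<in> sigma_sets UNIV {C. closed C}" using that by (simp add: borel_eq_closed)
    ultimately show ?thesis
    proof (induction rule: sigma_sets_induct_disjoint)
      case (basic A)
      then show ?case using cl by simp
    next
      case empty
      show ?case using cl[of "{}"] by simp
    next
      case (compl A)
      then have A: "S \<inter> A \<in> sets ?M" by (intro inS) (simp add: borel_eq_closed)
      have "\<rho> (S \<inter> (UNIV - A)) = \<rho> S - \<rho> (S \<inter> A)" if "\<rho> \<in> signed_measures ?M" for \<rho>
      proof -
        have "S \<inter> (UNIV - A) = S - S \<inter> A" by auto
        then show ?thesis using signed_measure_Diff[OF that _ A, of S] sets.top[of ?M] by simp
      qed
      from this[OF \<mu>] this[OF \<nu>] show ?case using compl cl[of UNIV] by simp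
    next
      case (union A)
      have "A n \<in> sets borel" for n using union(2) by (auto simp: borel_eq_closed)
      then have A: "S \<inter> A n \<in> sets ?M" for n by (rule inS)
      have "(\<lambda>n. \<rho> (S \<inter> A n)) sums \<rho> (\<Union>n. S \<inter> A n)" if "\<rho> \<in> signed_measures ?M" for \<rho>
        using union(1) A by (intro signed_measure_sums[OF that]) (auto simp: disjoint_family_on_def)
      from this[OF \<mu>] this[OF \<nu>] show ?case
        using union by (simp add: sums_unique2)
    qed
  qed
  show "\<mu> = \<nu>"
  proof
    fix A
    show "\<mu> A = \<nu> A"
    proof (cases "A \<in> sets ?M")
      case True
      then show ?thesis using borel by (auto simp: sets_restrict_space)
    next
      case False
      then show ?thesis using \<mu> \<nu> by (simp add: signed_measures_def)
    qed
  qed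
qed

lemma diff_in_signed_measures:
  assumes "finite_measure N1" "finite_measure N2" and s: "sets N1 = sets M" "sets N2 = sets M"
  shows "(\<lambda>A. if A \<in> sets M then measure N1 A - measure N2 A else 0) \<in> signed_measures M"
proof -
  interpret N1: finite_measure N1 by fact
  interpret N2: finite_measure N2 by fact
  have "(\<lambda>n. measure N1 (A n) - measure N2 (A n)) sums (measure N1 (\<Union>n. A n) - measure N2 (\<Union>n. A n))"
    if "range A \<subseteq> sets M" "disjoint_family A" for A :: "nat \<Rightarrow> 'a set"
    using that s by (intro sums_diff N1.finite_measure_UNION N2.finite_measure_UNION) auto
  then show ?thesis
    by (auto simp: signed_measures_def range_subsetD sets.countable_UN)
qed

section \<open>Existence and uniqueness of slices\<close>

definition location :: "'a mass_point \<Rightarrow> 'a" where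
  "location p = snd (rep_mass_point p)"

lemma mass_rep: "mass p = fst (rep_mass_point p)"
  by (metis Quotient_mass_point Quotient_abs_rep mass.abs_eq)

lemma abs_location: "abs_mass_point (mass p, location p) = p"
  by (metis Quotient_mass_point Quotient_abs_rep mass_rep location_def prod.collapse)

lemma location_abs: "r \<noteq> 0 \<Longrightarrow> location (abs_mass_point (r, x)) = x"
  using Quotient_rep_abs[OF Quotient_mass_point, of "(r, x)"] unfolding location_def
  by (metis mass_rel.elims(2) mass_rel.simps snd_conv mass_point.abs_eq_iff)

lemma weighted_location: "weighted \<psi> p = mass p * \<psi> (location p)"
  by (metis abs_location weighted.abs_eq case_prod_conv)

lemma dist_mass_point: "dist p q = d_F (mass p, location p) (mass q, location q)"
  by (metis abs_location dist_mass_point.abs_eq)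

lemma continuous_on_location: "continuous_on {p. mass p \<noteq> 0} (location :: 'a::metric_space mass_point \<Rightarrow> 'a)"
  unfolding continuous_on_iff
proof (intro ballI allI impI)
  fix p :: "'a mass_point" and e :: real
  assume p: "p \<in> {p. mass p \<noteq> 0}" and e: "0 < e"
  define m where "m = \<bar>mass p\<bar> / 2"
  have m: "0 < m" using p by (simp add: m_def)
  show "\<exists>d>0. \<forall>q\<in>{p. mass p \<noteq> 0}. dist q p < d \<longrightarrow> dist (location q) (location p) < e"
  proof (intro exI conjI ballI impI)
    show "0 < min m (m * e)" using m e by simp
    fix q assume "dist q p < min m (m * e)"
    then have d: "dist q p < m" "dist q p < m * e" by auto
    have mq: "m < \<bar>mass q\<bar>" using dist_mass_le[of q p] d(1) unfolding m_def by linarith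
    have mp: "m \<le> \<bar>mass p\<bar>" by (simp add: m_def)
    have "\<not> (mass q * mass p \<le> 0 \<or> 2 \<le> dist (location q) (location p))"
    proof
      assume "mass q * mass p \<le> 0 \<or> 2 \<le> dist (location q) (location p)"
      then have "dist q p = \<bar>mass q\<bar> + \<bar>mass p\<bar>" by (simp add: dist_mass_point)
      then show False using d(1) mq by linarith
    qed
    then have "dist q p = \<bar>mass q - mass p\<bar> + min (\<bar>mass q\<bar>) (\<bar>mass p\<bar>) * dist (location q) (location p)"
      by (simp add: dist_mass_point)
    moreover have "m * dist (location q) (location p) \<le> min (\<bar>mass q\<bar>) (\<bar>mass p\<bar>) * dist (location q) (location p)"
      using mq mp by (intro mult_right_mono) auto
    ultimately have "m * dist (location q) (location p) < m * e" using d(2) by linarith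
    then show "dist (location q) (location p) < e" using m by simp
  qed
qed

lemma continuous_on_mass: "continuous_on UNIV (mass :: 'a::metric_space mass_point \<Rightarrow> real)"
  unfolding continuous_on_iff by (metis dist_mass_le dist_real_def order_le_less_trans)

lemma dist_eval_le: "dist (eval c t) (eval d t) \<le> dist c d"
proof (cases "t \<in> {0..1}")
  case True
  then show ?thesis unfolding dist_curve_def by (rule cSUP_upper[OF _ bdd_above_dist_eval])
next
  case False
  then have "eval c t = eval d t" by transfer auto
  then show ?thesis by simp
qed

lemma continuous_on_eval: "continuous_on UNIV (\<lambda>c :: 'a::metric_space curve. eval c t)"
  unfolding continuous_on_iff by (metis dist_eval_le order_le_less_trans)

lemma location_curves_in:
  assumes "\<gamma> \<in> curves_in K" "mass (eval \<gamma> t) \<noteq> 0"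
  shows "location (eval \<gamma> t) \<in> K"
proof -
  obtain h \<xi> where g: "curve_pair (h, \<xi>)" "\<xi> ` {0..1} \<subseteq> K" "\<gamma> = abs_curve (h, \<xi>)"
    using assms by (auto simp: curves_in_def)
  have "curve_rel (h, \<xi>) (h, \<xi>)" using g by (auto simp: curve_rel_def)
  then have e: "eval \<gamma> t = abs_mass_point (if t \<in> {0..1} then (h t, \<xi> t) else (0, undefined))"
    using eval.abs_eq[of "(h, \<xi>)"] g by simp
  with assms(2) have "t \<in> {0..1}" "h t \<noteq> 0" by (auto simp: mass.abs_eq split: if_splits)
  then show ?thesis using g e by (auto simp: location_abs)
qed

lemma slice_exists_unique:
  assumes K: "compact K" and \<Gamma>: "\<Gamma> \<subseteq> curves_in K" and \<sigma>: "\<sigma> \<in> finite_borel_measures \<Gamma>"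
  shows "\<exists>!\<rho>. \<rho> \<in> signed_measures (borel_on K) \<and>
     (\<forall>\<psi>. continuous_on K \<psi> \<longrightarrow>
        signed_integral (borel_on K) \<rho> \<psi> = (\<integral>\<gamma>. weighted \<psi> (eval \<gamma> t) \<partial>\<sigma>))"
proof (rule ex_ex1I)
  fix \<rho> \<rho>'
  assume "\<rho> \<in> signed_measures (borel_on K) \<and> (\<forall>\<psi>. continuous_on K \<psi> \<longrightarrow>
        signed_integral (borel_on K) \<rho> \<psi> = (\<integral>\<gamma>. weighted \<psi> (eval \<gamma> t) \<partial>\<sigma>))"
    and "\<rho>' \<in> signed_measures (borel_on K) \<and> (\<forall>\<psi>. continuous_on K \<psi> \<longrightarrow>
        signed_integral (borel_on K) \<rho>' \<psi> = (\<integral>\<gamma>. weighted \<psi> (eval \<gamma> t) \<partial>\<sigma>))"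
  then show "\<rho> = \<rho>'" by (intro signed_measure_eqI[of \<rho> K \<rho>']) auto
next
  interpret finite_measure \<sigma> using \<sigma> by (simp add: finite_borel_measures_def)
  have sets: "sets \<sigma> = sets (borel_on \<Gamma>)" using \<sigma> by (simp add: finite_borel_measures_def)
  have space: "space \<sigma> = \<Gamma>" using sets_eq_imp_space_eq[OF sets] by (simp add: space_restrict_space)
  define x0 where "x0 = (SOME x. x \<in> K)"
  define m where "m \<gamma> = mass (eval \<gamma> t)" for \<gamma> :: "'a curve"
  define l where "l \<gamma> = (if m \<gamma> \<noteq> 0 then location (eval \<gamma> t) else x0)" for \<gamma>
  have m_cont: "continuous_on UNIV m"
    unfolding m_def by (rule continuous_on_compose2[OF continuous_on_mass continuous_on_eval]) simp
  have meas: "f \<in> borel_measurable \<sigma>" if "f \<in> borel_measurable borel" for f :: "'a curve \<Rightarrow> 'b::topological_space"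
    using measurable_restrict_space1[OF that, of \<Gamma>] measurable_cong_sets[OF sets refl] by blast
  have m_meas [measurable]: "m \<in> borel_measurable \<sigma>"
    by (intro meas borel_measurable_continuous_onI m_cont)
  have "open {\<gamma>. m \<gamma> \<noteq> 0}"
    using m_cont by (intro open_Collect_neq continuous_on_const)
  moreover have "continuous_on {\<gamma>. m \<gamma> \<noteq> 0} (\<lambda>\<gamma>. location (eval \<gamma> t))"
    by (rule continuous_on_compose2[OF continuous_on_location])
      (auto simp: m_def intro: continuous_on_subset[OF continuous_on_eval])
  ultimately have "(\<lambda>\<gamma>. if \<gamma> \<in> {\<gamma>. m \<gamma> \<noteq> 0} then location (eval \<gamma> t) else x0) \<in> borel_measurable borel"
    by (intro borel_measurable_continuous_on_if continuous_on_const) auto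
  then have "l \<in> borel_measurable \<sigma>" unfolding l_def by (intro meas) simp
  moreover have lK: "l \<gamma> \<in> K" if "\<gamma> \<in> \<Gamma>" for \<gamma>
  proof (cases "m \<gamma> = 0")
    case True
    have "\<gamma> \<in> curves_in K" using that \<Gamma> by blast
    then obtain h \<xi> where "curve_pair (h, \<xi>)" "\<xi> ` {0..1::real} \<subseteq> K"
      unfolding curves_in_def by blast
    then have "\<xi> 0 \<in> K" by auto
    then show ?thesis using True someI[of "\<lambda>x. x \<in> K"] by (auto simp: l_def x0_def)
  next
    case False
    then show ?thesis using location_curves_in[of \<gamma> K t] that \<Gamma> by (auto simp: l_def m_def)
  qed
  ultimately have l_meas [measurable]: "l \<in> measurable \<sigma> (borel_on K)"
    by (intro measurable_restrict_space2) (auto simp: space)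
  define N where "N s = distr (density \<sigma> (\<lambda>\<gamma>. ennreal (s * m \<gamma>))) (borel_on K) l" for s :: real
  have m_bd: "\<bar>m \<gamma>\<bar> \<le> 1" for \<gamma> unfolding m_def by (rule mass_eval_bounded)
  have N_fin: "finite_measure (N s)" if "s \<in> {-1, 1}" for s
  proof -
    have "emeasure (density \<sigma> (\<lambda>\<gamma>. ennreal (s * m \<gamma>))) (space \<sigma>) = (\<integral>\<^sup>+\<gamma>. ennreal (s * m \<gamma>) \<partial>\<sigma>)"
      by (subst emeasure_density) (auto intro!: nn_integral_cong)
    also have "\<dots> \<le> (\<integral>\<^sup>+\<gamma>. 1 \<partial>\<sigma>)"
    proof (rule nn_integral_mono)
      fix \<gamma> show "ennreal (s * m \<gamma>) \<le> 1"
        using m_bd[of \<gamma>] that by (auto simp: abs_le_iff)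
    qed
    also have "\<dots> < \<infinity>" by (simp add: less_top[symmetric])
    finally show ?thesis unfolding N_def
      by (intro finite_measure.finite_measure_distr finite_measureI) (auto simp: less_top[symmetric])
  qed
  have N_sets: "sets (N s) = sets (borel_on K)" for s by (simp add: N_def)
  define \<rho> where "\<rho> A = (if A \<in> sets (borel_on K) then measure (N 1) A - measure (N (-1)) A else 0)" for A
  have \<rho>: "\<rho> \<in> signed_measures (borel_on K)"
    unfolding \<rho>_def[abs_def] using N_fin N_sets by (intro diff_in_signed_measures) auto
  have "signed_integral (borel_on K) \<rho> \<psi> = (\<integral>\<gamma>. weighted \<psi> (eval \<gamma> t) \<partial>\<sigma>)"
    if \<psi>: "continuous_on K \<psi>" for \<psi> :: "'a \<Rightarrow> real"
  proof -
    have \<psi>_meas [measurable]: "\<psi> \<in> borel_measurable (borel_on K)"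
      using \<psi> by (rule borel_measurable_continuous_on_restrict)
    obtain B where B: "\<And>x. x \<in> K \<Longrightarrow> \<bar>\<psi> x\<bar> \<le> B"
      using compact_imp_bounded[OF compact_continuous_image[OF \<psi> K]] by (auto simp: bounded_iff)
    have int: "integrable \<sigma> (\<lambda>\<gamma>. max 0 (s * m \<gamma>) * \<psi> (l \<gamma>))"
      and N_int: "(\<integral>x. \<psi> x \<partial>N s) = (\<integral>\<gamma>. max 0 (s * m \<gamma>) * \<psi> (l \<gamma>) \<partial>\<sigma>)" if "s \<in> {-1, 1}" for s
    proof -
      show "integrable \<sigma> (\<lambda>\<gamma>. max 0 (s * m \<gamma>) * \<psi> (l \<gamma>))"
      proof (rule integrable_const_bound[where B = "1 * B"])
        show "AE \<gamma> in \<sigma>. norm (max 0 (s * m \<gamma>) * \<psi> (l \<gamma>)) \<le> 1 * B"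
        proof (rule AE_I2)
          fix \<gamma> assume "\<gamma> \<in> space \<sigma>"
          then have "\<bar>\<psi> (l \<gamma>)\<bar> \<le> B" using lK space B by auto
          moreover have "\<bar>max 0 (s * m \<gamma>)\<bar> \<le> 1" using m_bd[of \<gamma>] that by (auto simp: abs_le_iff)
          ultimately show "norm (max 0 (s * m \<gamma>) * \<psi> (l \<gamma>)) \<le> 1 * B"
            unfolding real_norm_def abs_mult by (intro mult_mono) auto
        qed
      qed measurable
      have "ennreal (s * m \<gamma>) = ennreal (max 0 (s * m \<gamma>))" for \<gamma>
        by (cases "0 \<le> s * m \<gamma>") (auto simp: ennreal_neg max_def)
      then have "density \<sigma> (\<lambda>\<gamma>. ennreal (s * m \<gamma>)) = density \<sigma> (\<lambda>\<gamma>. ennreal (max 0 (s * m \<gamma>)))"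
        by presburger
      then show "(\<integral>x. \<psi> x \<partial>N s) = (\<integral>\<gamma>. max 0 (s * m \<gamma>) * \<psi> (l \<gamma>) \<partial>\<sigma>)"
        unfolding N_def by (simp add: integral_distr integral_density)
    qed
    have "signed_integral (borel_on K) \<rho> \<psi> = (\<integral>x. \<psi> x \<partial>N 1) - (\<integral>x. \<psi> x \<partial>N (-1))"
      using N_fin N_sets \<rho> B by (intro signed_integral_diff) (auto simp: \<rho>_def space_restrict_space)
    also have "\<dots> = (\<integral>\<gamma>. max 0 (1 * m \<gamma>) * \<psi> (l \<gamma>) - max 0 (-1 * m \<gamma>) * \<psi> (l \<gamma>) \<partial>\<sigma>)"
      using int[of 1] int[of "-1"] N_int[of 1] N_int[of "-1"] by (simp add: Bochner_Integration.integral_diff)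
    also have "\<dots> = (\<integral>\<gamma>. weighted \<psi> (eval \<gamma> t) \<partial>\<sigma>)"
      by (rule Bochner_Integration.integral_cong) (auto simp: weighted_location l_def m_def max_def)
    finally show ?thesis .
  qed
  with \<rho> show "\<exists>\<rho>. \<rho> \<in> signed_measures (borel_on K) \<and>
     (\<forall>\<psi>. continuous_on K \<psi> \<longrightarrow>
        signed_integral (borel_on K) \<rho> \<psi> = (\<integral>\<gamma>. weighted \<psi> (eval \<gamma> t) \<partial>\<sigma>))"
    by blast
qed

end

theory Submission
  imports Defs
begin

text \<open>The first-order optimality conditions suffice. Let \<open>L\<close> be the derivative of the data term
  at \<open>\<sigma>\<^sup>*\<close>, a function of \<open>\<gamma>(t\<^sub>0), \<dots>, \<gamma>(t\<^sub>T)\<close> only. Perturbing \<open>\<sigma>\<^sup>*\<close> to \<open>\<sigma>\<^sup>* + \<epsilon> \<delta>\<^sub>\<gamma>\<close> gives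
  \<open>L + w \<ge> 0\<close> on \<open>{w < \<infinity>}\<close>; perturbing it to \<open>(1 - \<epsilon>) \<sigma>\<^sup>*\<close> gives \<open>\<integral> (L + w) d\<sigma>\<^sup>* \<le> 0\<close>. Hence
  \<open>w = - L\<close> almost everywhere with respect to \<open>\<sigma>\<^sup>*\<close>, while \<open>w \<ge> - L\<close> for every competitor, at which
  \<open>L\<close> has the same value.\<close>

section \<open>Perturbing a measure by a point mass\<close>

lemma obtain_sum_measure:
  assumes "sets P = sets M"
  obtains N where "sets N = sets M"
    "\<And>f. f \<in> borel_measurable M \<Longrightarrow> (\<integral>\<^sup>+x. f x \<partial>N) = (\<integral>\<^sup>+x. f x \<partial>M) + (\<integral>\<^sup>+x. f x \<partial>P)"
proof
  let ?v = "\<lambda>A. emeasure M A + emeasure P A"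
  let ?N = "measure_of (space M) (sets M) ?v"
  show s: "sets ?N = sets M" by simp
  have ca: "countably_additive (sets M) ?v"
    unfolding countably_additive_def
  proof (intro allI impI)
    fix A :: "nat \<Rightarrow> 'a set"
    assume A: "range A \<subseteq> sets M" "disjoint_family A"
    have "(\<Sum>i. ?v (A i)) = (\<Sum>i. emeasure M (A i)) + (\<Sum>i. emeasure P (A i))"
      by (rule suminf_add[symmetric]) auto
    then show "(\<Sum>i. ?v (A i)) = ?v (\<Union>i. A i)"
      using A assms by (simp add: suminf_emeasure)
  qed
  have em: "emeasure ?N A = ?v A" if "A \<in> sets M" for A
    by (rule emeasure_measure_of[OF refl])
      (use that ca sets.space_closed in \<open>auto simp: positive_def\<close>)
  show "(\<integral>\<^sup>+x. f x \<partial>?N) = (\<integral>\<^sup>+x. f x \<partial>M) + (\<integral>\<^sup>+x. f x \<partial>P)" if f: "f \<in> borel_measurable M" for f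
  proof -
    \<comment> \<open>The null measure fills the fourth place of \<open>nn_integral_sum_eq\<close>,
      so that additivity on sets passes to integrals without a new induction.\<close>
    have "(\<integral>\<^sup>+x. f x \<partial>?N) + (\<integral>\<^sup>+x. f x \<partial>null_measure M) = (\<integral>\<^sup>+x. f x \<partial>M) + (\<integral>\<^sup>+x. f x \<partial>P)"
      by (rule nn_integral_sum_eq[OF s refl assms _ _ f]) (simp_all add: em)
    then show ?thesis by simp
  qed
qed

text \<open>The measure \<open>N\<close> plays the role of \<open>M\<close> plus mass
  \<open>e\<close> at \<open>x\<close>. The cost \<open>w\<close> takes values in
  \<open>ennreal\<close> while the moments are real, so both kinds of integral are provided; the
  real one follows by splitting into positive and negative parts.\<close>

lemma obtain_add_point_mass:
  assumes M: "finite_measure M" and x: "x \<in> space M" and e: "0 \<le> e"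
  obtains N where "finite_measure N" "sets N = sets M"
    "\<And>f. f \<in> borel_measurable M \<Longrightarrow> (\<integral>\<^sup>+y. f y \<partial>N) = (\<integral>\<^sup>+y. f y \<partial>M) + ennreal e * f x"
    "\<And>f :: 'a \<Rightarrow> real. integrable M f \<Longrightarrow> (\<integral>y. f y \<partial>N) = (\<integral>y. f y \<partial>M) + e * f x"
proof -
  interpret finite_measure M by fact
  \<comment> \<open>The image of a single atom of weight \<open>e\<close> under the constant map to
    \<open>x\<close>.\<close>
  define P where "P = distr (density (count_space {()}) (\<lambda>_. ennreal e)) M (\<lambda>_. x)"
  have P: "(\<integral>\<^sup>+y. f y \<partial>P) = ennreal e * f x" if "f \<in> borel_measurable M" for f
    using that x unfolding P_def
    by (simp add: nn_integral_distr nn_integral_density nn_integral_count_space_finite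
        emeasure_density mult.commute)
  obtain N where N: "sets N = sets M"
    "\<And>f. f \<in> borel_measurable M \<Longrightarrow> (\<integral>\<^sup>+x. f x \<partial>N) = (\<integral>\<^sup>+x. f x \<partial>M) + (\<integral>\<^sup>+x. f x \<partial>P)"
    by (rule obtain_sum_measure[of P M]) (auto simp: P_def)
  have nn: "(\<integral>\<^sup>+y. f y \<partial>N) = (\<integral>\<^sup>+y. f y \<partial>M) + ennreal e * f x" if "f \<in> borel_measurable M" for f
    using N(2)[OF that] P[OF that] by simp
  have sp: "space N = space M" using N(1) by (rule sets_eq_imp_space_eq)
  have "emeasure N (space N) = emeasure M (space M) + ennreal e"
    using nn[of "\<lambda>_. 1"] by (simp add: sp)
  then have fin: "finite_measure N" by (intro finite_measureI) (simp add: ennreal_add_eq_top)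
  have "(\<integral>y. f y \<partial>N) = (\<integral>y. f y \<partial>M) + e * f x" if f: "integrable M f" for f :: "'a \<Rightarrow> real"
  proof -
    have fm [measurable]: "f \<in> borel_measurable M" using f by simp
    have fN: "f \<in> borel_measurable N" using fm N(1) by (simp cong: measurable_cong_sets)
    have "(\<integral>\<^sup>+y. ennreal (norm (f y)) \<partial>N) < \<infinity>"
      using f by (subst nn) (auto simp: integrable_iff_bounded ennreal_mult_less_top)
    then have fN_int: "integrable N f" using fN by (simp add: integrable_iff_bounded)
    \<comment> \<open>The coercion \<open>ennreal\<close> cuts off negative values, so these are
      integrals of the positive part of \<open>g\<close>; the fact is applied to \<open>f\<close>
      and to \<open>- f\<close>.\<close>
    have parts: "enn2real (\<integral>\<^sup>+y. ennreal (g y) \<partial>N) = enn2real (\<integral>\<^sup>+y. ennreal (g y) \<partial>M) + e * max 0 (g x)"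
      if g: "integrable M g" for g
    proof -
      have "(\<integral>\<^sup>+y. ennreal (g y) \<partial>M) < \<infinity>" using g by (simp add: real_integrable_def less_top)
      moreover have "(\<integral>\<^sup>+y. ennreal (g y) \<partial>N) = (\<integral>\<^sup>+y. ennreal (g y) \<partial>M) + ennreal (e * max 0 (g x))"
        using g e by (subst nn) (auto simp: ennreal_mult max_def ennreal_neg)
      ultimately show ?thesis using e by (simp add: enn2real_plus)
    qed
    from parts[OF f] parts[of "\<lambda>y. - f y"] have "enn2real (\<integral>\<^sup>+y. ennreal (f y) \<partial>N) - enn2real (\<integral>\<^sup>+y. ennreal (- f y) \<partial>N) =
        (enn2real (\<integral>\<^sup>+y. ennreal (f y) \<partial>M) + e * max 0 (f x)) -
        (enn2real (\<integral>\<^sup>+y. ennreal (- f y) \<partial>M) + e * max 0 (- f x))"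
      using f by simp
    moreover have "e * max 0 (f x) - e * max 0 (- f x) = e * f x" by (simp add: max_def)
    ultimately show ?thesis
      unfolding real_lebesgue_integral_def[OF f] real_lebesgue_integral_def[OF fN_int]
      by linarith
  qed
  with fin N(1) nn that show thesis by blast
qed

section \<open>Moments of slices as integrals over curves\<close>

text \<open>The position is only known to be continuous where the mass does not vanish. That set of
  curves is open, the function is continuous on it, and it is \<open>0\<close> on the
  complement.\<close>

lemma borel_measurable_weighted_eval:
  fixes \<psi> :: "'a::metric_space \<Rightarrow> real"
  assumes "continuous_on UNIV \<psi>"
  shows "(\<lambda>\<gamma>. weighted \<psi> (eval \<gamma> t)) \<in> borel_measurable borel"
proof -
  have m: "continuous_on UNIV (\<lambda>\<gamma> :: 'a curve. mass (eval \<gamma> t))"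
    by (rule continuous_on_compose2[OF continuous_on_mass continuous_on_eval]) simp
  have l: "continuous_on {\<gamma> :: 'a curve. mass (eval \<gamma> t) \<noteq> 0} (\<lambda>\<gamma>. location (eval \<gamma> t))"
    by (rule continuous_on_compose2[OF continuous_on_location])
      (auto intro: continuous_on_subset[OF continuous_on_eval])
  have "(\<lambda>\<gamma>. if \<gamma> \<in> {\<gamma>. mass (eval \<gamma> t) \<noteq> 0} then weighted \<psi> (eval \<gamma> t) else 0) \<in> borel_measurable borel"
  proof (rule borel_measurable_continuous_on_if)
    show "{\<gamma> :: 'a curve. mass (eval \<gamma> t) \<noteq> 0} \<in> sets borel"
      using m by (intro borel_open open_Collect_neq continuous_on_const)
    show "continuous_on {\<gamma>. mass (eval \<gamma> t) \<noteq> 0} (\<lambda>\<gamma>. weighted \<psi> (eval \<gamma> t))"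
      unfolding weighted_location
      by (intro continuous_on_mult continuous_on_subset[OF m] continuous_on_compose2[OF assms l]) auto
  qed simp
  also have "(\<lambda>\<gamma>. if \<gamma> \<in> {\<gamma>. mass (eval \<gamma> t) \<noteq> 0} then weighted \<psi> (eval \<gamma> t) else 0)
      = (\<lambda>\<gamma>. weighted \<psi> (eval \<gamma> t))"
    by (auto simp: weighted_location)
  finally show ?thesis .
qed

text \<open>Masses are at most 1 in modulus and \<psi> is bounded on the compact set
  \<open>K\<close>, so the integrand is bounded and the measure is finite.\<close>

lemma integrable_weighted_eval:
  fixes K :: "'a::euclidean_space set" and \<psi> :: "'a \<Rightarrow> real"
  assumes K: "compact K" and \<Gamma>: "\<Gamma> \<subseteq> curves_in K" and \<sigma>: "\<sigma> \<in> finite_borel_measures \<Gamma>"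
    and \<psi>: "continuous_on K \<psi>"
  shows "integrable \<sigma> (\<lambda>\<gamma>. weighted \<psi> (eval \<gamma> t))"
proof -
  interpret finite_measure \<sigma> using \<sigma> by (simp add: finite_borel_measures_def)
  have sets: "sets \<sigma> = sets (borel_on \<Gamma>)" using \<sigma> by (simp add: finite_borel_measures_def)
  have space: "space \<sigma> = \<Gamma>" using sets_eq_imp_space_eq[OF sets] by (simp add: space_restrict_space)
  obtain B where B: "\<And>x. x \<in> K \<Longrightarrow> \<bar>\<psi> x\<bar> \<le> B" and "0 < B"
    using compact_imp_bounded[OF compact_continuous_image[OF \<psi> K]] by (auto simp: bounded_pos)
  \<comment> \<open>The preceding lemma asks for continuity on the whole space. Replacing \<psi> by
    a Tietze extension changes nothing on \<Gamma>, where positions of nonzero mass lie in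
    \<open>K\<close>.\<close>
  obtain \<phi> where \<phi>: "continuous_on UNIV \<phi>" "\<And>x. x \<in> K \<Longrightarrow> \<phi> x = \<psi> x"
    using Tietze_unbounded[OF \<psi>, of UNIV] compact_imp_closed[OF K] by auto
  have "(\<lambda>\<gamma>. weighted \<phi> (eval \<gamma> t)) \<in> borel_measurable \<sigma>"
    using measurable_restrict_space1[OF borel_measurable_weighted_eval[OF \<phi>(1), of t], of \<Gamma>]
      measurable_cong_sets[OF sets refl] by blast
  moreover have "weighted \<phi> (eval \<gamma> t) = weighted \<psi> (eval \<gamma> t)" if "\<gamma> \<in> space \<sigma>" for \<gamma>
    using that space \<Gamma> \<phi>(2) location_curves_in[of \<gamma> K t] by (auto simp: weighted_location)
  ultimately have meas: "(\<lambda>\<gamma>. weighted \<psi> (eval \<gamma> t)) \<in> borel_measurable \<sigma>"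
    by (rule measurable_cong[THEN iffD1, rotated])
  have "\<bar>weighted \<psi> (eval \<gamma> t)\<bar> \<le> B" if \<gamma>: "\<gamma> \<in> \<Gamma>" for \<gamma>
  proof (cases "mass (eval \<gamma> t) = 0")
    case True
    then show ?thesis using \<open>0 < B\<close> by (simp add: weighted_location)
  next
    case False
    then have "\<bar>\<psi> (location (eval \<gamma> t))\<bar> \<le> B" using \<gamma> \<Gamma> location_curves_in[of \<gamma> K t] B by auto
    then have "\<bar>mass (eval \<gamma> t)\<bar> * \<bar>\<psi> (location (eval \<gamma> t))\<bar> \<le> 1 * B"
      using mass_eval_bounded[of \<gamma> t] by (intro mult_mono) auto
    then show ?thesis by (simp add: weighted_location abs_mult)
  qed
  then show ?thesis
    using meas by (intro integrable_const_bound[where B = B] AE_I2) (auto simp: space)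
qed

text \<open>Existence and uniqueness of the slice release the property behind \<open>THE\<close>,
  which is then tested with the functions \<open>a i\<close>. Afterwards the moments are visibly
  linear in \<sigma> and slices no longer appear.\<close>

lemma moments_slice:
  fixes K :: "'a::euclidean_space set"
  assumes "compact K" "\<Gamma> \<subseteq> curves_in K" "\<sigma> \<in> finite_borel_measures \<Gamma>"
    and "\<And>i. continuous_on K (a i)"
  shows "moments K a (slice K \<sigma> t) = (\<chi> i. \<integral>\<gamma>. weighted (a i) (eval \<gamma> t) \<partial>\<sigma>)"
  using theI'[OF slice_exists_unique[OF assms(1-3)], of t] assms(4)
  unfolding moments_def slice_def by simp

section \<open>Auxiliary facts from calculus, linear algebra and measurability\<close>

text \<open>A negative derivative would push \<open>g\<close> below \<open>g 0\<close> immediately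
  to the right of 0. The range \<open>e < 1\<close> keeps the factor \<open>1 - e\<close> of the
  scaling perturbation positive.\<close>

lemma right_min_derivative_nonneg:
  fixes g :: "real \<Rightarrow> real"
  assumes "(g has_real_derivative D) (at 0)"
    and min: "\<And>e. 0 < e \<Longrightarrow> e < 1 \<Longrightarrow> g 0 \<le> g e"
  shows "0 \<le> D"
proof (rule ccontr)
  assume "\<not> 0 \<le> D"
  then obtain d where d: "0 < d" "\<And>h. 0 < h \<Longrightarrow> h < d \<Longrightarrow> g (0 + h) < g 0"
    using DERIV_neg_dec_right[OF assms(1)] by auto
  then have "g (min d 1 / 2) < g 0" by (auto simp: min_def)
  moreover have "g 0 \<le> g (min d 1 / 2)" using d(1) by (intro min) (auto simp: min_def)
  ultimately show False by simp
qed

text \<open>Coordinates reduce the exchange of a derivative with a vector of integrals to linearity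
  of real integrals.\<close>

lemma linear_vec_eq_sum:
  fixes f :: "real ^ 'm \<Rightarrow> real"
  assumes "linear f"
  shows "f v = (\<Sum>i\<in>UNIV. f (axis i 1) * v $ i)"
proof -
  have "f v = f (\<Sum>i\<in>UNIV. (v $ i) *\<^sub>R axis i 1)"
    by (simp add: basis_expansion flip: scalar_mult_eq_scaleR)
  also have "\<dots> = (\<Sum>i\<in>UNIV. f (axis i 1) * v $ i)"
    using assms by (simp add: linear_sum linear_cmul mult.commute)
  finally show ?thesis .
qed

text \<open>Compact sublevel sets are closed, hence Borel; the level \<infinity> gives all of
  \<open>S\<close>.\<close>

lemma borel_measurable_compact_sublevel:
  fixes w :: "'a::metric_space \<Rightarrow> ennreal"
  assumes "\<And>c. c < \<infinity> \<Longrightarrow> compact {x \<in> S. w x \<le> c}"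
  shows "w \<in> borel_measurable (borel_on S)"
proof (rule borel_measurableI_le)
  fix c
  show "{x \<in> space (borel_on S). w x \<le> c} \<in> sets (borel_on S)"
  proof (cases "c = \<infinity>")
    case True
    then show ?thesis using sets.top[of "borel_on S"] by simp
  next
    case False
    then have "{x \<in> S. w x \<le> c} \<in> sets borel"
      using assms[of c] by (intro borel_closed compact_imp_closed) (simp add: less_top)
    moreover have "{x \<in> S. w x \<le> c} = S \<inter> {x \<in> S. w x \<le> c}" by auto
    ultimately show ?thesis by (auto simp: sets_restrict_space space_restrict_space)
  qed
qed

section \<open>Perturbation of the minimiser\<close>

theorem lemma3p3:
  fixes \<Omega> :: "'a::euclidean_space set"
    and \<Gamma> :: "'a curve set"
    and T :: nat
    and t :: "nat \<Rightarrow> real"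
    and a :: "nat \<Rightarrow> 'm::finite \<Rightarrow> 'a \<Rightarrow> real"
    and F :: "nat \<Rightarrow> real ^ 'm \<Rightarrow> real"
    and w :: "'a curve \<Rightarrow> ennreal"
    and \<sigma>s :: "'a curve measure"
  assumes "open \<Omega>" and "bounded \<Omega>" and "convex \<Omega>"
    and "closedin (top_of_set (curves_in (closure \<Omega>))) \<Gamma>"
    and "\<And>j. j \<le> T \<Longrightarrow> t j \<in> {0..1}"
    and "\<And>j i. j \<le> T \<Longrightarrow> continuous_on (closure \<Omega>) (a j i)"
    and "\<And>j. j \<le> T \<Longrightarrow> twice_continuously_differentiable (F j)"
    and "\<And>j x. j \<le> T \<Longrightarrow> 0 \<le> F j x"
    and "\<And>j. j \<le> T \<Longrightarrow> convex_on UNIV (F j)"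
    and "lower_semicontinuous_on \<Gamma> w"
    and "\<And>c. c < \<infinity> \<Longrightarrow> compact {\<gamma> \<in> \<Gamma>. w \<gamma> \<le> c}"
    and "is_arg_min (energy (closure \<Omega>) T t a F w) (\<lambda>\<sigma>. \<sigma> \<in> finite_borel_measures \<Gamma>) \<sigma>s"
  shows "AE \<gamma> in \<sigma>s. \<gamma> \<in> measure_support \<sigma>s \<longrightarrow>
           \<gamma> \<in> optimal_curves \<Gamma> T t w (\<lambda>j. eval \<gamma> (t j))"
proof -
  let ?K = "closure \<Omega>"
  let ?E = "energy ?K T t a F w"
  have K: "compact ?K" using \<open>bounded \<Omega>\<close> by simp
  have \<Gamma>: "\<Gamma> \<subseteq> curves_in ?K" using assms(4) by (simp add: closedin_def)
  have \<sigma>s: "\<sigma>s \<in> finite_borel_measures \<Gamma>"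
    and min: "\<And>\<tau>. \<tau> \<in> finite_borel_measures \<Gamma> \<Longrightarrow> ?E \<sigma>s \<le> ?E \<tau>"
    using assms(12) by (auto simp: is_arg_min_def not_less)
  interpret finite_measure \<sigma>s using \<sigma>s by (simp add: finite_borel_measures_def)
  have sets: "sets \<sigma>s = sets (borel_on \<Gamma>)" using \<sigma>s by (simp add: finite_borel_measures_def)
  have space: "space \<sigma>s = \<Gamma>" using sets_eq_imp_space_eq[OF sets] by (simp add: space_restrict_space)
  have w_meas [measurable]: "w \<in> borel_measurable \<sigma>s"
    using borel_measurable_compact_sublevel[OF assms(11)] sets by (simp cong: measurable_cong_sets)
  \<comment> \<open>The data term sees a measure only through the integrals of these functions, and
    each of them sees a curve only through its value at \<open>t j\<close>.\<close>
  define q where "q j i \<gamma> = weighted (a j i) (eval \<gamma> (t j))" for j i \<gamma>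
  have q_int: "integrable \<sigma>s (q j i)" if "j \<le> T" for j i
    unfolding q_def[abs_def] using K \<Gamma> \<sigma>s assms(6)[OF that] by (rule integrable_weighted_eval)
  have data: "data_term ?K T t a F \<tau> = (\<Sum>j\<le>T. F j (\<chi> i. \<integral>\<gamma>. q j i \<gamma> \<partial>\<tau>))"
    if "\<tau> \<in> finite_borel_measures \<Gamma>" for \<tau>
    unfolding data_term_def q_def by (intro sum.cong refl) (simp add: moments_slice[OF K \<Gamma> that] assms(6))
  define x where "x j = (\<chi> i. \<integral>\<gamma>. q j i \<gamma> \<partial>\<sigma>s)" for j
  have "\<forall>j. \<exists>D. j \<le> T \<longrightarrow> (F j has_derivative D) (at (x j))"
    using assms(7) unfolding twice_continuously_differentiable_def by blast
  then obtain F' where F': "\<And>j. j \<le> T \<Longrightarrow> (F j has_derivative F' j) (at (x j))"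
    by metis
  have lin: "linear (F' j)" if "j \<le> T" for j using F'[OF that] by (rule has_derivative_linear)
  \<comment> \<open>The vector with entries \<open>q j i \<gamma>\<close> is the moment vector of
    the unit point mass at \<gamma>, so this is the derivative of the data term in that
    direction.\<close>
  define L where "L \<gamma> = (\<Sum>j\<le>T. F' j (\<chi> i. q j i \<gamma>))" for \<gamma>

  \<comment> \<open>Comparison with the zero measure, whose energy is finite, makes the total cost
    of the minimiser finite and hence a real number \<open>W\<close>.\<close>
  have "?E \<sigma>s \<le> ?E (null_measure (borel_on \<Gamma>))"
    by (rule min) (auto simp: finite_borel_measures_def intro!: finite_measureI)
  also have "\<dots> < \<infinity>" by (simp add: energy_def less_top[symmetric])
  finally have W_fin: "(\<integral>\<^sup>+\<gamma>. w \<gamma> \<partial>\<sigma>s) < \<infinity>" by (simp add: energy_def less_top)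
  define W where "W = enn2real (\<integral>\<^sup>+\<gamma>. w \<gamma> \<partial>\<sigma>s)"
  have W: "(\<integral>\<^sup>+\<gamma>. w \<gamma> \<partial>\<sigma>s) = ennreal W" "0 \<le> W" using W_fin by (auto simp: W_def less_top)

  \<comment> \<open>Both perturbations are instances: \<open>d\<close> is the velocity of the
    moments and \<open>v\<close> that of the total cost along a family of competitors, both of which
    move affinely in \<open>e\<close>.\<close>
  have first_order: "0 \<le> (\<Sum>j\<le>T. F' j (d j)) + v"
    if "\<And>e. 0 < e \<Longrightarrow> e < 1 \<Longrightarrow> \<exists>\<tau>\<in>finite_borel_measures \<Gamma>. 0 \<le> W + e * v \<and>
        (\<integral>\<^sup>+\<gamma>. w \<gamma> \<partial>\<tau>) = ennreal (W + e * v) \<and>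
        (\<forall>j\<le>T. (\<chi> i. \<integral>\<gamma>. q j i \<gamma> \<partial>\<tau>) = x j + e *\<^sub>R d j)" for d v
  proof (rule right_min_derivative_nonneg)
    show "((\<lambda>e. (\<Sum>j\<le>T. F j (x j + e *\<^sub>R d j)) + e * v) has_real_derivative
        (\<Sum>j\<le>T. F' j (d j)) + v) (at 0)"
    proof (intro DERIV_add DERIV_sum)
      fix j assume "j \<in> {..T}"
      then have j: "j \<le> T" by simp
      have "((\<lambda>e. F j (x j + e *\<^sub>R d j)) has_derivative (\<lambda>e. F' j (e *\<^sub>R d j))) (at 0)"
        by (rule has_derivative_compose[where f = "\<lambda>e. x j + e *\<^sub>R d j" and g = "F j"])
          (use F'[OF j] in \<open>auto intro!: derivative_eq_intros\<close>)
      then show "((\<lambda>e. F j (x j + e *\<^sub>R d j)) has_real_derivative F' j (d j)) (at 0)"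
        unfolding has_field_derivative_def using lin[OF j]
        by (simp add: linear_cmul mult.commute[of _ "F' j (d j)"])
    qed (auto intro!: derivative_eq_intros)
    fix e :: real assume "0 < e" "e < 1"
    from that[OF this] obtain \<tau> where \<tau>: "\<tau> \<in> finite_borel_measures \<Gamma>" "0 \<le> W + e * v"
        "(\<integral>\<^sup>+\<gamma>. w \<gamma> \<partial>\<tau>) = ennreal (W + e * v)"
        "\<forall>j\<le>T. (\<chi> i. \<integral>\<gamma>. q j i \<gamma> \<partial>\<tau>) = x j + e *\<^sub>R d j" by blast
    have nonneg: "0 \<le> (\<Sum>j\<le>T. F j (y j))" for y
      using assms(8) by (intro sum_nonneg) auto
    have "data_term ?K T t a F \<tau> = (\<Sum>j\<le>T. F j (x j + e *\<^sub>R d j))"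
      unfolding data[OF \<tau>(1)] using \<tau>(4) by (intro sum.cong) auto
    moreover have "data_term ?K T t a F \<sigma>s = (\<Sum>j\<le>T. F j (x j))"
      unfolding data[OF \<sigma>s] x_def ..
    ultimately have "ennreal ((\<Sum>j\<le>T. F j (x j)) + W) \<le> ennreal ((\<Sum>j\<le>T. F j (x j + e *\<^sub>R d j)) + (W + e * v))"
      using min[OF \<tau>(1)] \<tau>(2,3) W nonneg by (simp add: energy_def ennreal_plus[symmetric] del: ennreal_plus)
    \<comment> \<open>Since \<open>ennreal\<close> truncates at 0, the inequality returns to the
      reals only once its right-hand side is known to be nonnegative.\<close>
    moreover have "0 \<le> (\<Sum>j\<le>T. F j (x j + e *\<^sub>R d j)) + (W + e * v)"
      using \<tau>(2) nonneg by (rule add_nonneg_nonneg[rotated])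
    ultimately show "(\<Sum>j\<le>T. F j (x j + 0 *\<^sub>R d j)) + 0 * v \<le> (\<Sum>j\<le>T. F j (x j + e *\<^sub>R d j)) + e * v"
      by (simp add: ennreal_le_iff)
  qed

  \<comment> \<open>Adding mass \<open>e\<close> at \<gamma> moves the total cost at rate
    \<open>w \<gamma>\<close>; its finiteness makes this an admissible real
    \<open>v\<close>.\<close>
  have lower: "0 \<le> L \<gamma> + enn2real (w \<gamma>)" if \<gamma>: "\<gamma> \<in> \<Gamma>" "w \<gamma> < \<infinity>" for \<gamma>
    unfolding L_def
  proof (rule first_order)
    fix e :: real assume e: "0 < e" "e < 1"
    obtain \<tau> where \<tau>: "finite_measure \<tau>" "sets \<tau> = sets \<sigma>s"
      "\<And>f. f \<in> borel_measurable \<sigma>s \<Longrightarrow> (\<integral>\<^sup>+y. f y \<partial>\<tau>) = (\<integral>\<^sup>+y. f y \<partial>\<sigma>s) + ennreal e * f \<gamma>"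
      "\<And>f :: 'a curve \<Rightarrow> real. integrable \<sigma>s f \<Longrightarrow> (\<integral>y. f y \<partial>\<tau>) = (\<integral>y. f y \<partial>\<sigma>s) + e * f \<gamma>"
      by (rule obtain_add_point_mass[OF finite_measure_axioms, of \<gamma> e]) (use \<gamma> e space in auto)
    show "\<exists>\<tau>\<in>finite_borel_measures \<Gamma>. 0 \<le> W + e * enn2real (w \<gamma>) \<and>
        (\<integral>\<^sup>+\<gamma>. w \<gamma> \<partial>\<tau>) = ennreal (W + e * enn2real (w \<gamma>)) \<and>
        (\<forall>j\<le>T. (\<chi> i. \<integral>\<gamma>. q j i \<gamma> \<partial>\<tau>) = x j + e *\<^sub>R (\<chi> i. q j i \<gamma>))"
      using \<tau>(1,2) \<tau>(3)[OF w_meas] \<tau>(4)[OF q_int] W e \<gamma> sets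
      by (intro bexI[of _ \<tau>])
        (auto simp: finite_borel_measures_def x_def vec_eq_iff ennreal_mult less_top)
  qed

  \<comment> \<open>Scaling by \<open>1 - e\<close> moves moments and total cost towards 0, with
    velocities \<open>- x j\<close> and \<open>- W\<close>.\<close>
  have upper: "0 \<le> (\<Sum>j\<le>T. F' j (- x j)) + - W"
  proof (rule first_order)
    fix e :: real assume e: "0 < e" "e < 1"
    define \<tau> where "\<tau> = density \<sigma>s (\<lambda>_. ennreal (1 - e))"
    have "(\<integral>\<^sup>+\<gamma>. w \<gamma> \<partial>\<tau>) = ennreal (W + e * (- W))"
      unfolding \<tau>_def using e W
      by (simp add: nn_integral_density nn_integral_cmult flip: ennreal_mult) (simp add: algebra_simps)
    moreover have "(\<integral>\<gamma>. q j i \<gamma> \<partial>\<tau>) = (1 - e) * (\<integral>\<gamma>. q j i \<gamma> \<partial>\<sigma>s)" if "j \<le> T" for j i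
      unfolding \<tau>_def using e q_int[OF that, of i] by (subst integral_density) auto
    moreover have "finite_measure \<tau>"
    proof (rule finite_measureI)
      have "emeasure \<tau> (space \<tau>) = ennreal (1 - e) * emeasure \<sigma>s (space \<sigma>s)"
        unfolding \<tau>_def by (subst emeasure_density) (auto simp: nn_integral_cmult_indicator)
      then show "emeasure \<tau> (space \<tau>) \<noteq> \<infinity>" by (simp add: ennreal_mult_eq_top_iff)
    qed
    then have "\<tau> \<in> finite_borel_measures \<Gamma>"
      by (simp add: finite_borel_measures_def \<tau>_def sets)
    moreover have "0 \<le> (1 - e) * W" using e W by (intro mult_nonneg_nonneg) auto
    ultimately show "\<exists>\<tau>\<in>finite_borel_measures \<Gamma>. 0 \<le> W + e * (- W) \<and>
        (\<integral>\<^sup>+\<gamma>. w \<gamma> \<partial>\<tau>) = ennreal (W + e * (- W)) \<and>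
        (\<forall>j\<le>T. (\<chi> i. \<integral>\<gamma>. q j i \<gamma> \<partial>\<tau>) = x j + e *\<^sub>R (- x j))"
      by (intro bexI[of _ \<tau>]) (auto simp: x_def vec_eq_iff algebra_simps)
  qed

  \<comment> \<open>Equality almost everywhere and comparison with competitors\<close>
  have L_sum: "L \<gamma> = (\<Sum>j\<le>T. \<Sum>i\<in>UNIV. F' j (axis i 1) * q j i \<gamma>)" for \<gamma>
    unfolding L_def using linear_vec_eq_sum[OF lin] by (intro sum.cong) auto
  have L_int: "integrable \<sigma>s L"
    unfolding L_sum[abs_def] using q_int by (intro Bochner_Integration.integrable_sum) auto
  have "(\<integral>\<gamma>. L \<gamma> \<partial>\<sigma>s) = (\<Sum>j\<le>T. \<Sum>i\<in>UNIV. F' j (axis i 1) * (\<integral>\<gamma>. q j i \<gamma> \<partial>\<sigma>s))"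
    unfolding L_sum using q_int by (simp add: Bochner_Integration.integral_sum)
  also have "\<dots> = (\<Sum>j\<le>T. F' j (x j))"
    using linear_vec_eq_sum[OF lin] by (intro sum.cong) (auto simp: x_def)
  also have "\<dots> = - (\<Sum>j\<le>T. F' j (- x j))"
    using lin by (simp add: linear_neg sum_negf)
  finally have L_le: "(\<integral>\<gamma>. L \<gamma> \<partial>\<sigma>s) + W \<le> 0" using upper by simp
  have w_fin: "AE \<gamma> in \<sigma>s. w \<gamma> < \<infinity>"
    using nn_integral_PInf_AE[OF w_meas] W_fin by (auto simp: less_top)
  \<comment> \<open>The function \<open>enn2real\<close> sends \<infinity> to 0, which alters
    \<open>w\<close> only on a null set.\<close>
  have W_eq: "(\<integral>\<^sup>+\<gamma>. ennreal (enn2real (w \<gamma>)) \<partial>\<sigma>s) = ennreal W"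
    unfolding W(1)[symmetric] using w_fin by (intro nn_integral_cong_AE) (auto simp: less_top)
  have w_int: "integrable \<sigma>s (\<lambda>\<gamma>. enn2real (w \<gamma>))"
    using W_eq by (intro integrableI_nonneg) auto
  have "(\<integral>\<gamma>. enn2real (w \<gamma>) \<partial>\<sigma>s) = W"
    using W_eq W(2) by (simp add: integral_eq_nn_integral)
  then have "(\<integral>\<gamma>. L \<gamma> + enn2real (w \<gamma>) \<partial>\<sigma>s) \<le> 0"
    using L_int w_int L_le by simp
  moreover have nonneg: "AE \<gamma> in \<sigma>s. 0 \<le> L \<gamma> + enn2real (w \<gamma>)"
    using w_fin AE_space by eventually_elim (simp add: lower space)
  \<comment> \<open>A function that is nonnegative almost everywhere and has nonpositive integral
    vanishes almost everywhere.\<close>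
  ultimately have "(\<integral>\<gamma>. L \<gamma> + enn2real (w \<gamma>) \<partial>\<sigma>s) = 0"
    using integral_nonneg_AE[OF nonneg] by simp
  then have "AE \<gamma> in \<sigma>s. L \<gamma> + enn2real (w \<gamma>) = 0"
    using integral_nonneg_eq_0_iff_AE[OF _ nonneg] L_int w_int by simp
  with w_fin AE_space show ?thesis
  proof eventually_elim
    case (elim \<gamma>)
    have "w \<gamma> \<le> w \<gamma>'"
      if "\<gamma>' \<in> \<Gamma>" "\<forall>j\<le>T. eval \<gamma>' (t j) = eval \<gamma> (t j)" "w \<gamma>' < \<infinity>" for \<gamma>'
    proof -
      have "L \<gamma>' = L \<gamma>" unfolding L_def q_def using that(2) by (intro sum.cong) auto
      then have "enn2real (w \<gamma>) \<le> enn2real (w \<gamma>')" using lower[OF that(1,3)] elim by simp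
      then have "ennreal (enn2real (w \<gamma>)) \<le> ennreal (enn2real (w \<gamma>'))" by (rule ennreal_leI)
      \<comment> \<open>Both costs are finite, so the real comparison loses nothing.\<close>
      moreover have "ennreal (enn2real (w \<gamma>)) = w \<gamma>" "ennreal (enn2real (w \<gamma>')) = w \<gamma>'"
        using elim that(3) by (simp_all add: ennreal_enn2real)
      ultimately show ?thesis by (simp only:)
    qed
    then show ?case
      using elim space by (auto simp: optimal_curves_def is_arg_min_def not_less[symmetric])
  qed
qed

end
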